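(* Let $\alpha$ be the parameter of a family of very simple increasing trees, and let $S(\mathcal{T}_n)$ be the number of nodes in the subtree consisting of the centroid (the one nearest to the root) and all of its descendants in a random tree of size $n$. As $n\to\infty$, the proportion $S(\mathcal{T}_n)/n$ converges in distribution to the random variable $\mathcal{S}$ whose law is given on $[1/2,1)$ by the density $$f(\theta)=4\,\frac{\alpha}{\alpha-1}\left(\alpha(2\theta)^{-(\alpha+1)}-(2\theta)^{-2}\right)$$ and at $\theta=1$ by the point measure $$P(\mathcal{S}=1)=1-\frac{\alpha}{\alpha-1}\left(1-2^{-(\alpha-1)}\right).$$ (For $\alpha=1$ these expressions are to be read as their limits as $\alpha\to1$.)
   Context: Random trees. An increasing tree of size $n$ is a rooted tree with $n$ nodes labelled $1,\dots,n$ such that labels increase along every path leading away from the root (so the root has label $1$). A family of very simple increasing trees is given by real constants $c_1>0$ and $c_2$; put $\alpha=1+c_2/c_1>0$. The admissible cases are: $c_2=0$, $\alpha=1$ (general recursive trees); $c_2<0$, $0<\alpha<1$ (general plane-oriented trees); $c_2>0$, $\alpha=d/(d-1)$ with an integer $d\ge2$ (general $d$-ary increasing trees). A plane (i.e. ordered) increasing tree $T$ has weight $\omega(T)=\prod_v\phi_{\mathrm{outdeg}(v)}$, where $\sum_i\phi_iu^i=\phi(u)$ with $\phi(u)=\exp(c_1u)$ if $c_2=0$ and $\phi(u)=(1+c_2u)^{1+c_1/c_2}$ otherwise; a random tree $\mathcal{T}_n$ of size $n$ is drawn with probability proportional to its weight. Equivalently (ignoring the order of children), the random tree is produced by the growth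 process which starts with the root $1$ and, for $i=2,\dots,n$, attaches node $i$ as a child to an existing node of current out-degree $k$ with probability $\frac{\alpha-(\alpha-1)k}{i+\alpha-2}$. Centroid. A centroid of a tree is a node minimising the sum of distances to all other nodes; equivalently, each branch at the node (maximal subtree not containing it) contains at most half of the nodes of the tree. Every tree has one centroid or two adjacent centroids; "the centroid" means the one nearest to the root. *)

theory Defs
  imports "HOL-Probability.Probability" "HOL-Real_Asymp.Real_Asymp"
begin

datatype ptree = Node (label: nat) (children: "ptree list")

primrec labels :: "ptree \<Rightarrow> nat list" where
  "labels (Node l ts) = l # concat (map labels ts)"

primrec increasing :: "ptree \<Rightarrow> bool" where
  "increasing (Node l ts) \<longleftrightarrow> (\<forall>t\<in>set ts. l < label t) \<and> list_all increasing ts"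

text \<open>The children of a node form a list, so the trees are plane (ordered) trees.\<close>

definition increasing_trees :: "nat \<Rightarrow> ptree set" where
  "increasing_trees n = {T. increasing T \<and> distinct (labels T) \<and> set (labels T) = {1..n}}"

definition admissible :: "real \<Rightarrow> real \<Rightarrow> bool" where
  "admissible c1 c2 \<longleftrightarrow> c1 > 0 \<and>
     (let \<alpha> = 1 + c2 / c1 in
        c2 = 0
      \<or> (c2 < 0 \<and> 0 < \<alpha> \<and> \<alpha> < 1)
      \<or> (c2 > 0 \<and> (\<exists>d::nat. d \<ge> 2 \<and> \<alpha> = real d / (real d - 1))))"

definition phi :: "real \<Rightarrow> real \<Rightarrow> real \<Rightarrow> real" where
  "phi c1 c2 u = (if c2 = 0 then exp (c1 * u) else (1 + c2 * u) powr (1 + c1 / c2))"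

text \<open>Taylor coefficients at 0; closed forms are \<open>phi_coeff_exp\<close> and \<open>phi_coeff_powr\<close> below.\<close>

definition phi_coeff :: "real \<Rightarrow> real \<Rightarrow> nat \<Rightarrow> real" where
  "phi_coeff c1 c2 i = (deriv ^^ i) (phi c1 c2) 0 / fact i"

primrec weight :: "real \<Rightarrow> real \<Rightarrow> ptree \<Rightarrow> real" where
  "weight c1 c2 (Node l ts) = phi_coeff c1 c2 (length ts) * prod_list (map (weight c1 c2) ts)"

text \<open>For admissible parameters and \<open>n \<ge> 1\<close> the function below is a probability mass function,
  see \<open>pmf_random_tree\<close>.\<close>

definition random_tree :: "real \<Rightarrow> real \<Rightarrow> nat \<Rightarrow> ptree pmf" where
  "random_tree c1 c2 n = embed_pmf (\<lambda>T.
     if T \<in> increasing_trees n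
     then weight c1 c2 T / (\<Sum>T'\<in>increasing_trees n. weight c1 c2 T') else 0)"

text \<open>Nodes are identified with their labels; edges point from parent to child.\<close>

primrec edges :: "ptree \<Rightarrow> (nat \<times> nat) set" where
  "edges (Node l ts) = {l} \<times> label ` set ts \<union> \<Union> (set (map edges ts))"

definition tree_dist :: "ptree \<Rightarrow> nat \<Rightarrow> nat \<Rightarrow> nat" where
  "tree_dist T u v = (LEAST k. (u, v) \<in> (edges T \<union> (edges T)\<inverse>) ^^ k)"

definition centroids :: "ptree \<Rightarrow> nat set" where
  "centroids T = {v \<in> set (labels T). \<forall>w \<in> set (labels T).
     (\<Sum>u\<in>set (labels T). tree_dist T v u) \<le> (\<Sum>u\<in>set (labels T). tree_dist T w u)}"

text \<open>Among the at most two centroids, the one closest to the root.\<close>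

definition centroid :: "ptree \<Rightarrow> nat" where
  "centroid T = arg_min_on (tree_dist T (label T)) (centroids T)"

definition centroid_subtree_size :: "ptree \<Rightarrow> nat" where
  "centroid_subtree_size T = card {w. (centroid T, w) \<in> (edges T)\<^sup>*}"

definition limit_density :: "real \<Rightarrow> real \<Rightarrow> real" where
  "limit_density \<alpha> \<theta> =
     (let f = \<lambda>a. 4 * (a / (a - 1)) * (a * (2 * \<theta>) powr (- (a + 1)) - (2 * \<theta>) powr (-2))
      in if \<alpha> = 1 then Lim (at 1) f else f \<alpha>)"

definition limit_atom :: "real \<Rightarrow> real" where
  "limit_atom \<alpha> =
     (let p = \<lambda>a. 1 - a / (a - 1) * (1 - 2 powr (- (a - 1)))
      in if \<alpha> = 1 then Lim (at 1) p else p \<alpha>)"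

text \<open>An absolutely continuous part on [1/2,1) plus an atom at 1; that this set function really is
  a measure is \<open>emeasure_limit_law\<close>.\<close>

definition limit_law :: "real \<Rightarrow> real measure" where
  "limit_law \<alpha> = measure_of UNIV (sets borel) (\<lambda>A.
     (\<integral>\<^sup>+\<theta>\<in>A \<inter> {1/2..<1}. ennreal (limit_density \<alpha> \<theta>) \<partial>lborel)
     + ennreal (limit_atom \<alpha>) * indicator A 1)"

text \<open>The readings at \<open>\<alpha> = 1\<close> in closed form, and well-definedness of the objects above.\<close>

lemma limit_density_1:
  assumes "\<theta> > 0"
  shows "limit_density 1 \<theta> = (1 - ln (2 * \<theta>)) / \<theta>\<^sup>2"
proof -
  define x where "x = 2 * \<theta>"
  have x: "x > 0" using assms by (simp add: x_def)
  let ?g = "\<lambda>a::real. a * x powr (- (a + 1))"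
  have d: "(?g has_real_derivative (1 - ln x) / x\<^sup>2) (at 1)"
    using x by (auto intro!: derivative_eq_intros simp: powr_minus powr_numeral field_simps power2_eq_square)
  have lim: "4 * 1 * ((1 - ln x) / x\<^sup>2) = (1 - ln (2 * \<theta>)) / \<theta>\<^sup>2"
    using assms by (simp add: x_def power_mult_distrib field_simps)
  have "((\<lambda>a. (?g a - ?g 1) / (a - 1)) \<longlongrightarrow> (1 - ln x) / x\<^sup>2) (at 1)"
    using d by (simp only: has_field_derivative_iff)
  hence "((\<lambda>a. 4 * a * ((?g a - ?g 1) / (a - 1))) \<longlongrightarrow> 4 * 1 * ((1 - ln x) / x\<^sup>2)) (at 1)"
    using tendsto_mult[OF tendsto_mult[OF tendsto_const tendsto_ident_at]] by blast
  hence "((\<lambda>a. 4 * (a / (a - 1)) * (a * x powr (- (a + 1)) - x powr (-2))) \<longlongrightarrow> (1 - ln (2 * \<theta>)) / \<theta>\<^sup>2) (at 1)"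
    unfolding lim by (simp add: x_def)
  thus ?thesis
    unfolding limit_density_def by (simp add: x_def tendsto_Lim)
qed

lemma limit_atom_1: "limit_atom 1 = 1 - ln 2"
proof -
  have "((\<lambda>a. 1 - a / (a - 1) * (1 - 2 powr (- (a - 1)))) \<longlongrightarrow> 1 - ln 2) (at (1::real))"
    by real_asymp
  thus ?thesis unfolding limit_atom_def by (simp add: tendsto_Lim)
qed

lemma emeasure_limit_law:
  assumes "A \<in> sets borel"
  shows "emeasure (limit_law \<alpha>) A =
    (\<integral>\<^sup>+\<theta>\<in>A \<inter> {1/2..<1}. ennreal (limit_density \<alpha> \<theta>) \<partial>lborel)
      + ennreal (limit_atom \<alpha>) * indicator A 1"
proof -
  have m1: "(\<lambda>\<theta>. ennreal (limit_density \<alpha> \<theta>) * indicator {1/2..<1} \<theta>) \<in> borel_measurable borel"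
  proof (cases "\<alpha> = 1")
    case True
    have "(\<lambda>\<theta>. ennreal ((1 - ln (2 * \<theta>)) / \<theta>\<^sup>2) * indicator {1/2..<1} \<theta>) \<in> borel_measurable borel"
      by measurable
    also have "?this \<longleftrightarrow> ?thesis"
      by (intro measurable_cong) (auto simp: True limit_density_1 indicator_def)
    finally show ?thesis .
  next
    case False
    then show ?thesis unfolding limit_density_def Let_def by simp
  qed
  let ?D = "density lborel (\<lambda>\<theta>. ennreal (limit_density \<alpha> \<theta>) * indicator {1/2..<1} \<theta>)"
  let ?R = "scale_measure (ennreal (limit_atom \<alpha>)) (return borel (1::real))"
  let ?\<mu> = "\<lambda>A. (\<integral>\<^sup>+\<theta>\<in>A \<inter> {1/2..<1}. ennreal (limit_density \<alpha> \<theta>) \<partial>lborel)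
      + ennreal (limit_atom \<alpha>) * indicator A (1::real)"
  have eq: "?\<mu> B = emeasure ?D B + emeasure ?R B" if "B \<in> sets borel" for B
    using that m1 by (subst emeasure_density)
      (auto intro!: nn_integral_cong simp: indicator_inter_arith mult_ac)
  have ca: "countably_additive (sets borel) ?\<mu>"
  proof (rule countably_additiveI)
    fix B :: "nat \<Rightarrow> real set" assume B: "range B \<subseteq> sets borel" "disjoint_family B" "(\<Union>i. B i) \<in> sets borel"
    have "(\<Sum>i. ?\<mu> (B i)) = (\<Sum>i. emeasure ?D (B i) + emeasure ?R (B i))"
      using B by (intro suminf_cong eq) auto
    also have "\<dots> = (\<Sum>i. emeasure ?D (B i)) + (\<Sum>i. emeasure ?R (B i))"
      by (intro suminf_add[symmetric]) auto
    also have "\<dots> = emeasure ?D (\<Union>i. B i) + emeasure ?R (\<Union>i. B i)"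
      using B by (intro arg_cong2[where f="(+)"] suminf_emeasure) auto
    also have "\<dots> = ?\<mu> (\<Union>i. B i)" by (rule eq[OF B(3), symmetric])
    finally show "(\<Sum>i. ?\<mu> (B i)) = ?\<mu> (\<Union>i. B i)" .
  qed
  have "emeasure (limit_law \<alpha>) A = ?\<mu> A"
  proof (rule emeasure_measure_of[OF limit_law_def])
    show "A \<in> sets (limit_law \<alpha>)" using assms unfolding limit_law_def
      by (metis (no_types, lifting) sets.sigma_sets_eq sets_measure_of space_borel subset_UNIV Pow_UNIV)
    show "positive (sets (limit_law \<alpha>)) ?\<mu>" by (simp add: positive_def)
    show "countably_additive (sets (limit_law \<alpha>)) ?\<mu>"
      using ca unfolding limit_law_def
      by (metis (no_types, lifting) sets.sigma_sets_eq sets_measure_of space_borel subset_UNIV Pow_UNIV)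
  qed auto
  thus ?thesis .
qed

lemma phi_coeff_exp: "phi_coeff c1 0 i = c1 ^ i / fact i"
proof -
  have "(deriv ^^ i) (\<lambda>u. exp (c1 * u)) = (\<lambda>u. c1 ^ i * exp (c1 * u))"
  proof (induction i)
    case (Suc i)
    have "deriv (\<lambda>u. c1 ^ i * exp (c1 * u)) u = c1 ^ Suc i * exp (c1 * u)" for u
      by (rule DERIV_imp_deriv) (auto intro!: derivative_eq_intros)
    with Suc show ?case by auto
  qed auto
  thus ?thesis by (simp add: phi_coeff_def phi_def[abs_def])
qed

lemma phi_coeff_powr:
  assumes "c2 \<noteq> 0"
  shows "phi_coeff c1 c2 i = ((1 + c1 / c2) gchoose i) * c2 ^ i"
proof -
  define b where "b = 1 + c1 / c2"
  define V where "V = {u. 1 + c2 * u > 0}"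
  have "open V" unfolding V_def by (intro open_Collect_less continuous_intros)
  have "(deriv ^^ i) (phi c1 c2) u = c2 ^ i * (\<Prod>k<i. b - real k) * (1 + c2 * u) powr (b - real i)"
    if "u \<in> V" for u
    using that
  proof (induction i arbitrary: u)
    case 0 thus ?case using assms by (simp add: phi_def b_def)
  next
    case (Suc i)
    have "(deriv ^^ Suc i) (phi c1 c2) u
       = deriv (\<lambda>u. c2 ^ i * (\<Prod>k<i. b - real k) * (1 + c2 * u) powr (b - real i)) u"
      using Suc \<open>open V\<close> by (auto intro!: deriv_cong_ev eventually_nhds_in_open[THEN eventually_mono])
    also have "\<dots> = c2 ^ Suc i * (\<Prod>k<Suc i. b - real k) * (1 + c2 * u) powr (b - real (Suc i))"
      using Suc.prems
      by (intro DERIV_imp_deriv) (auto intro!: derivative_eq_intros simp: V_def powr_diff[of _ _ 1] powr_add algebra_simps)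
    finally show ?case .
  qed
  from this[of 0] show ?thesis
    by (simp add: phi_coeff_def V_def gbinomial_prod_rev b_def atLeast0LessThan)
qed


lemma finite_increasing_trees: "finite (increasing_trees n)"
proof -
  have fin: "finite {T. length (labels T) \<le> m \<and> set (labels T) \<subseteq> {1..n}}" for m
  proof (induction m)
    case 0
    have "labels T \<noteq> []" for T by (cases T) auto
    thus ?case by simp
  next
    case (Suc m)
    let ?F = "{T. length (labels T) \<le> m \<and> set (labels T) \<subseteq> {1..n}}"
    have len: "length ts \<le> length (concat (map labels ts))" for ts
    proof (induction ts)
      case (Cons t ts) thus ?case by (cases t) auto
    qed auto
    have mem: "length (labels t) \<le> length (concat (map labels ts))" if "t \<in> set ts" for t ts
      using that by (induction ts) auto
    have "{T. length (labels T) \<le> Suc m \<and> set (labels T) \<subseteq> {1..n}}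
        \<subseteq> (\<lambda>(l, ts). Node l ts) ` ({1..n} \<times> {ts. set ts \<subseteq> ?F \<and> length ts \<le> m})"
    proof
      fix T assume T: "T \<in> {T. length (labels T) \<le> Suc m \<and> set (labels T) \<subseteq> {1..n}}"
      obtain l ts where [simp]: "T = Node l ts" by (cases T)
      have c: "length (concat (map labels ts)) \<le> m" "l \<in> {1..n}" "\<forall>t\<in>set ts. set (labels t) \<subseteq> {1..n}"
        using T by auto
      have "set ts \<subseteq> ?F" using c(1,3) order_trans[OF mem c(1)] by auto
      moreover have "length ts \<le> m" using c(1) len[of ts] by linarith
      ultimately show "T \<in> (\<lambda>(l, ts). Node l ts) ` ({1..n} \<times> {ts. set ts \<subseteq> ?F \<and> length ts \<le> m})"
        using c(2) by (intro image_eqI[of _ _ "(l, ts)"]) auto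
    qed
    thus ?case
      using Suc finite_subset[OF _ finite_imageI[OF finite_cartesian_product[OF _ finite_lists_length_le]]]
      by blast
  qed
  have "length (labels T) \<le> n" if "T \<in> increasing_trees n" for T
    using that distinct_card[of "labels T"] by (simp add: increasing_trees_def)
  thus ?thesis
    by (intro finite_subset[OF _ fin[of n]]) (auto simp: increasing_trees_def)
qed

lemma phi_coeff_nonneg:
  assumes "admissible c1 c2"
  shows "phi_coeff c1 c2 i \<ge> 0"
proof -
  have c1: "c1 > 0" using assms by (simp add: admissible_def)
  consider "c2 = 0" | "c2 < 0" "1 + c2 / c1 > 0"
    | d where "c2 > 0" "d \<ge> (2::nat)" "1 + c2 / c1 = real d / (real d - 1)"
    using assms by (auto simp: admissible_def Let_def)
  thus ?thesis
  proof cases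
    case 1 thus ?thesis using c1 by (simp add: phi_coeff_exp)
  next
    case 2
    hence "1 + c1 / c2 < 0" using c1 by (simp add: field_simps)
    hence "(\<Prod>k<i. (1 + c1 / c2 - real k) * c2) \<ge> 0"
      using 2 by (intro prod_nonneg) (auto intro!: mult_nonpos_nonpos)
    thus ?thesis using 2
      by (simp add: phi_coeff_powr gbinomial_prod_rev atLeast0LessThan prod.distrib)
  next
    case 3
    hence "c2 / c1 = 1 / (real d - 1)" by (simp add: field_simps)
    hence "1 + c1 / c2 = real d" using 3 c1 by (simp add: field_simps)
    thus ?thesis using 3 by (simp add: phi_coeff_powr binomial_gbinomial[symmetric])
  qed
qed

lemma weight_nonneg: "admissible c1 c2 \<Longrightarrow> weight c1 c2 T \<ge> 0"
  by (induction T) (auto intro!: mult_nonneg_nonneg prod_list_nonneg phi_coeff_nonneg)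

lemma path_exists:
  assumes "admissible c1 c2"
  shows "\<exists>T. label T = a \<and> increasing T \<and> labels T = [a..<a + Suc n] \<and> weight c1 c2 T > 0"
proof -
  have c1: "c1 > 0" using assms by (simp add: admissible_def)
  have p0: "phi_coeff c1 c2 0 = 1" by (simp add: phi_coeff_def phi_def)
  have "1 + c2 / c1 > 0" using assms by (auto simp: admissible_def Let_def)
  hence "c1 + c2 > 0" using c1 by (simp add: field_simps)
  moreover have "(1 + c1 / c2) * c2 = c1 + c2" if "c2 \<noteq> 0"
    using that by (simp add: distrib_right)
  ultimately have "phi_coeff c1 c2 1 > 0"
    using c1 by (cases "c2 = 0") (simp_all add: phi_coeff_exp phi_coeff_powr)
  thus ?thesis
  proof (induction n arbitrary: a)
    case 0 thus ?case using p0 by (intro exI[of _ "Node a []"]) auto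
  next
    case (Suc n)
    then obtain T where "label T = Suc a" "increasing T" "labels T = [Suc a..<Suc a + Suc n]" "weight c1 c2 T > 0"
      by blast
    thus ?case using Suc.prems by (intro exI[of _ "Node a [T]"]) (auto simp: upt_conv_Cons)
  qed
qed

lemma pmf_random_tree:
  assumes "admissible c1 c2" "n \<ge> 1"
  shows "pmf (random_tree c1 c2 n) T =
    (if T \<in> increasing_trees n
     then weight c1 c2 T / (\<Sum>T'\<in>increasing_trees n. weight c1 c2 T') else 0)"
proof -
  let ?W = "\<Sum>T'\<in>increasing_trees n. weight c1 c2 T'"
  let ?p = "\<lambda>T. if T \<in> increasing_trees n then weight c1 c2 T / ?W else 0"
  obtain P where "increasing P" "labels P = [1..<1 + Suc (n - 1)]" "weight c1 c2 P > 0"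
    using path_exists[OF assms(1), of 1 "n - 1"] by auto
  hence "P \<in> increasing_trees n" using assms(2) by (auto simp: increasing_trees_def)
  hence W: "?W > 0" using \<open>weight c1 c2 P > 0\<close> weight_nonneg[OF assms(1)]
    by (intro sum_pos2[of _ P]) (auto simp: finite_increasing_trees)
  show ?thesis unfolding random_tree_def
  proof (rule pmf_embed_pmf)
    show nn: "0 \<le> ?p T" for T using W weight_nonneg[OF assms(1)] by simp
    have "(\<integral>\<^sup>+T. ennreal (?p T) \<partial>count_space UNIV)
      = (\<integral>\<^sup>+T. ennreal (weight c1 c2 T / ?W) \<partial>count_space (increasing_trees n))"
      by (subst nn_integral_count_space_indicator) (auto intro!: nn_integral_cong simp: indicator_def)
    also have "\<dots> = (\<Sum>T\<in>increasing_trees n. ennreal (weight c1 c2 T / ?W))"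
      by (rule nn_integral_count_space_finite[OF finite_increasing_trees])
    also have "\<dots> = ennreal (\<Sum>T\<in>increasing_trees n. weight c1 c2 T / ?W)"
      using W weight_nonneg[OF assms(1)] by (intro sum_ennreal) simp
    also have "\<dots> = 1" using W by (simp add: sum_divide_distrib[symmetric])
    finally show "(\<integral>\<^sup>+T. ennreal (?p T) \<partial>count_space UNIV) = 1" .
  qed
qed

end

theory Submission
  imports Defs
begin

text \<open>
Call the subtree of a node the node together with its descendants. Subtrees with more than \<open>n/2\<close> nodes intersect, so
their roots form a path starting at the root of the tree. Moving from a node to a child whose subtree has \<open>s\<close> nodes
changes the sum of distances by \<open>n - 2 s\<close>; hence this sum decreases along the heavy path and nowhere else, and the last
node of the path is the centroid nearest to the root (\<open>centroid_heavy_end\<close>). The random variable is thus the smallest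
size of a subtree with more than \<open>n/2\<close> nodes.

For \<open>n div 2 \<le> M < n\<close> this size is at most \<open>M\<close> if and only if the heavy path passes from a subtree of more than \<open>M\<close>
nodes to one of at most \<open>M\<close> nodes, and it does so at most once. The probability of this event is therefore an expected
number of parent-child pairs, namely those whose parent has subtree size \<open>m > M\<close> and whose child has subtree size \<open>j\<close>
with \<open>n div 2 < j \<le> M\<close> (\<open>child_stat_crossing\<close>). An expected number is additive, so no joint distribution along the
path is needed, only the expected number of pairs with given sizes \<open>(m, j)\<close>.

These numbers come from the growth process. Deleting the node with the largest label maps trees of size \<open>n + 1\<close> to
trees of size \<open>n\<close>, and the weights of the trees over a given one realise attachment rates \<open>\<alpha> - (\<alpha> - 1) k\<close> at
nodes of outdegree \<open>k\<close>. A subtree with \<open>j\<close> nodes is hit at rate \<open>j + \<alpha> - 1\<close>, as in a Polya urn, and so the numbers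
of pairs obey a linear recursion. It closes up once the attachment rate of a node is counted as an amount of children of
size 0 (\<open>sum_child_stat_graft\<close>), and its solution is an explicit product (\<open>child_total_at_pair\<close>).

Summing this product over \<open>m\<close> and \<open>j\<close> telescopes to the exact formula \<open>prob_centroid_subtree_size_le\<close>. It
involves ratios of \<open>growth_ratio\<close>, which behave like powers with exponent \<open>\<alpha> - 1\<close>, or harmonic sums if
\<open>\<alpha> = 1\<close>. With \<open>M = x n\<close> the formula tends to \<open>limit_cdf \<alpha> x\<close>, an antiderivative of the limit density, for
\<open>1/2 \<le> x < 1\<close>. The remaining values of \<open>x\<close> are trivial, so that the distribution functions converge at every point.
\<close>

section \<open>Growing an increasing tree by its largest label\<close>

text \<open>All plane trees obtained from a tree by hanging a new leaf \<open>x\<close> below one of its nodes, in any position among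
the children of that node. A node with \<open>k\<close> children therefore contributes \<open>k + 1\<close> trees, which is the factor that
turns a ratio of consecutive \<open>phi_coeff\<close>s into an attachment rate.\<close>

fun graft :: "nat \<Rightarrow> ptree \<Rightarrow> ptree list"
  and graft_forest :: "nat \<Rightarrow> ptree list \<Rightarrow> ptree list list" where
  "graft x (Node l ts) = map (Node l) (graft_forest x ts)"
| "graft_forest x [] = [[Node x []]]"
| "graft_forest x (t # ts) =
     (Node x [] # t # ts) # map (\<lambda>t'. t' # ts) (graft x t) @ map ((#) t) (graft_forest x ts)"

text \<open>The left inverse of \<open>graft\<close>. It drops every subtree whose root, a proper descendant, is labelled \<open>x\<close>; it is meant for
trees in which that node is a leaf.\<close>

fun prune :: "nat \<Rightarrow> ptree \<Rightarrow> ptree"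
  and prune_forest :: "nat \<Rightarrow> ptree list \<Rightarrow> ptree list" where
  "prune x (Node l ts) = Node l (prune_forest x ts)"
| "prune_forest x [] = []"
| "prune_forest x (t # ts) =
     (if label t = x then prune_forest x ts else prune x t # prune_forest x ts)"

lemma label_in_labels: "label T \<in> set (labels T)"
  by (cases T) auto

lemma labels_graft:
  "T' \<in> set (graft x T) \<Longrightarrow> mset (labels T') = add_mset x (mset (labels T))"
  "ts' \<in> set (graft_forest x ts) \<Longrightarrow>
     mset (concat (map labels ts')) = add_mset x (mset (concat (map labels ts)))"
  by (induction x T and x ts arbitrary: T' and ts' rule: graft_graft_forest.induct) auto

lemma label_graft: "T' \<in> set (graft x T) \<Longrightarrow> label T' = label T"
  by (cases T) auto

lemma increasing_graft:
  "T' \<in> set (graft x T) \<Longrightarrow> increasing T \<Longrightarrow> \<forall>y\<in>set (labels T). y < x \<Longrightarrow> increasing T'"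
  "ts' \<in> set (graft_forest x ts) \<Longrightarrow> list_all increasing ts \<Longrightarrow>
     \<forall>t\<in>set ts. \<forall>y\<in>set (labels t). y < x \<Longrightarrow> \<forall>t\<in>set ts. l < label t \<Longrightarrow> l < x \<Longrightarrow>
     list_all increasing ts' \<and> (\<forall>t\<in>set ts'. l < label t)"
proof (induction x T and x ts arbitrary: T' and ts' l rule: graft_graft_forest.induct)
  case (1 x l ts)
  then show ?case by force
next
  case (2 x)
  then show ?case by auto
next
  case (3 x t ts)
  then show ?case by (force dest: label_graft)
qed

lemma prune_fresh:
  "x \<notin> set (labels T) \<Longrightarrow> prune x T = T"
  "x \<notin> set (concat (map labels ts)) \<Longrightarrow> prune_forest x ts = ts"
  using label_in_labels
  by (induction x T and x ts rule: prune_prune_forest.induct) auto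

lemma prune_graft:
  "T' \<in> set (graft x T) \<Longrightarrow> x \<notin> set (labels T) \<Longrightarrow> prune x T' = T"
  "ts' \<in> set (graft_forest x ts) \<Longrightarrow> x \<notin> set (concat (map labels ts)) \<Longrightarrow>
     prune_forest x ts' = ts"
proof (induction x T and x ts arbitrary: T' and ts' rule: graft_graft_forest.induct)
  case (3 x t ts)
  have "label t \<noteq> x" "prune x t = t" "prune_forest x ts = ts"
    using 3(4) label_in_labels[of t] prune_fresh by auto
  moreover have "label t' \<noteq> x" if "t' \<in> set (graft x t)" for t'
    using label_graft[OF that] calculation by simp
  ultimately show ?case using 3 by auto
qed auto

lemma distinct_graft:
  "x \<notin> set (labels T) \<Longrightarrow> distinct (graft x T)"
  "x \<notin> set (concat (map labels ts)) \<Longrightarrow> distinct (graft_forest x ts)"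
proof (induction x T and x ts rule: graft_graft_forest.induct)
  case (3 x t ts)
  have "label t \<noteq> x" using 3(3) label_in_labels[of t] by auto
  then have "label t' \<noteq> x" if "t' \<in> set (graft x t)" for t'
    using label_graft[OF that] by simp
  moreover have "t \<notin> set (graft x t)" using labels_graft(1)[of t x t] by auto
  ultimately show ?case using 3 \<open>label t \<noteq> x\<close>
    by (auto simp: distinct_map inj_on_def)
qed (auto simp: distinct_map inj_on_def)

text \<open>The largest label of an increasing tree sits at a leaf, so nothing else is lost by pruning it. The version for forests
carries a lower bound \<open>l\<close> for the root labels, which is the increasing condition at their parent.\<close>

lemma graft_prune:
  "x \<in> set (labels T) \<Longrightarrow> label T \<noteq> x \<Longrightarrow> distinct (labels T) \<Longrightarrow> increasing T \<Longrightarrow>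
     \<forall>y\<in>set (labels T). y \<le> x \<Longrightarrow> T \<in> set (graft x (prune x T)) \<and> increasing (prune x T)"
  "x \<in> set (concat (map labels ts)) \<Longrightarrow> distinct (concat (map labels ts)) \<Longrightarrow>
     list_all increasing ts \<Longrightarrow> \<forall>t\<in>set ts. \<forall>y\<in>set (labels t). y \<le> x \<Longrightarrow> \<forall>t\<in>set ts. l < label t \<Longrightarrow>
     ts \<in> set (graft_forest x (prune_forest x ts)) \<and> list_all increasing (prune_forest x ts) \<and>
     (\<forall>t\<in>set (prune_forest x ts). l < label t)"
proof (induction x T and x ts arbitrary: and l rule: prune_prune_forest.induct)
  case (1 x l ts)
  then show ?case by force
next
  case (2 x)
  then show ?case by auto
next
  case (3 x t ts)
  have lp: "label (prune x t) = label t" by (cases t) auto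
  show ?case
  proof (cases "label t = x")
    case True
    obtain us where t: "t = Node x us" using True by (cases t) auto
    have "us = []"
    proof (cases us)
      case (Cons u us')
      then show ?thesis using 3(6,7) label_in_labels[of u] t by force
    qed simp
    moreover have "x \<notin> set (concat (map labels ts))" using 3(5) t by auto
    ultimately have "prune_forest x (t # ts) = ts" "t # ts \<in> set (graft_forest x ts)"
      using True t prune_fresh(2)[of x ts] by (cases ts; auto)+
    then show ?thesis using 3(6,8) by simp
  next
    case False
    show ?thesis
    proof (cases "x \<in> set (labels t)")
      case True
      then have x: "x \<notin> set (concat (map labels ts))" using 3(5) by auto
      have "t \<in> set (graft x (prune x t)) \<and> increasing (prune x t)"
        using 3(2)[OF False True False] 3(5-7) by auto
      then show ?thesis using False x 3(6-8) prune_fresh(2)[OF x] lp by auto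
    next
      case F: False
      have "ts \<in> set (graft_forest x (prune_forest x ts)) \<and> list_all increasing (prune_forest x ts) \<and>
        (\<forall>t\<in>set (prune_forest x ts). l < label t)"
        using 3(3)[OF False] 3(4-8) F by auto
      then show ?thesis using False F prune_fresh(1)[OF F] 3(6-8) by auto
    qed
  qed
qed

lemma increasing_root_least: "increasing T \<Longrightarrow> y \<in> set (labels T) \<Longrightarrow> label T \<le> y"
proof (induction T)
  case (Node l ts)
  show ?case
  proof (cases "y = l")
    case False
    then obtain t where "t \<in> set ts" "y \<in> set (labels t)" using Node.prems by auto
    then show ?thesis using Node by (force simp: list_all_iff)
  qed simp
qed

lemma increasing_trees_Suc:
  assumes "n \<ge> 1"
  shows "increasing_trees (Suc n) = (\<Union>T\<in>increasing_trees n. set (graft (Suc n) T))"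
proof (intro equalityI subsetI)
  fix T assume "T \<in> increasing_trees (Suc n)"
  then have T: "increasing T" "distinct (labels T)" "set (labels T) = {1..Suc n}"
    by (auto simp: increasing_trees_def)
  have "label T \<le> 1" using increasing_root_least[OF T(1), of 1] T(3) by simp
  then have g: "T \<in> set (graft (Suc n) (prune (Suc n) T))" and i: "increasing (prune (Suc n) T)"
    using graft_prune(1)[of "Suc n" T] T assms by auto
  have m: "mset (labels T) = add_mset (Suc n) (mset (labels (prune (Suc n) T)))"
    by (rule labels_graft(1)[OF g])
  have d: "distinct (Suc n # labels (prune (Suc n) T))"
    using T(2) m using mset_eq_imp_distinct_iff[of "labels T" "Suc n # labels (prune (Suc n) T)"] by simp
  moreover have "insert (Suc n) (set (labels (prune (Suc n) T))) = {1..Suc n}"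
    using T(3) mset_eq_setD[of "labels T" "Suc n # labels (prune (Suc n) T)"] m by simp
  ultimately have "set (labels (prune (Suc n) T)) = {1..Suc n} - {Suc n}" by auto
  also have "\<dots> = {1..n}" by auto
  finally have "set (labels (prune (Suc n) T)) = {1..n}" .
  then have "prune (Suc n) T \<in> increasing_trees n" using i d by (auto simp: increasing_trees_def)
  then show "T \<in> (\<Union>T\<in>increasing_trees n. set (graft (Suc n) T))" using g by auto
next
  fix T' assume "T' \<in> (\<Union>T\<in>increasing_trees n. set (graft (Suc n) T))"
  then obtain T where T: "increasing T" "distinct (labels T)" "set (labels T) = {1..n}"
    and g: "T' \<in> set (graft (Suc n) T)"
    by (auto simp: increasing_trees_def)
  have m: "mset (labels T') = mset (Suc n # labels T)" using labels_graft(1)[OF g] by simp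
  have "set (labels T') = {1..Suc n}" using mset_eq_setD[OF m] T(3) by auto
  moreover have "distinct (labels T')" using mset_eq_imp_distinct_iff[OF m] T by simp
  ultimately show "T' \<in> increasing_trees (Suc n)"
    using increasing_graft(1)[OF g T(1)] T(3) by (auto simp: increasing_trees_def)
qed

text \<open>The trees grafted onto different trees are different, since pruning recovers the original. Summation over trees thus
becomes one step of the growth process.\<close>

lemma sum_increasing_trees_Suc:
  assumes "n \<ge> 1"
  shows "(\<Sum>T\<in>increasing_trees (Suc n). f T) =
    (\<Sum>T\<in>increasing_trees n. \<Sum>T'\<leftarrow>graft (Suc n) T. f T' :: real)"
proof -
  have fresh: "Suc n \<notin> set (labels T)" if "T \<in> increasing_trees n" for T
    using that by (auto simp: increasing_trees_def)
  have "(\<Sum>T\<in>increasing_trees (Suc n). f T) =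
      (\<Sum>T\<in>increasing_trees n. \<Sum>T'\<in>set (graft (Suc n) T). f T')"
    unfolding increasing_trees_Suc[OF assms]
  proof (rule sum.UNION_disjoint)
    show "\<forall>T\<in>increasing_trees n. \<forall>U\<in>increasing_trees n. T \<noteq> U \<longrightarrow>
        set (graft (Suc n) T) \<inter> set (graft (Suc n) U) = {}"
      using fresh prune_graft(1) by (metis disjoint_iff)
  qed (auto simp: finite_increasing_trees)
  also have "\<dots> = (\<Sum>T\<in>increasing_trees n. \<Sum>T'\<leftarrow>graft (Suc n) T. f T')"
    using fresh distinct_graft(1) by (intro sum.cong refl sum.distinct_set_conv_list) auto
  finally show ?thesis .
qed

lemma increasing_trees_1: "increasing_trees (Suc 0) = {Node 1 []}"
proof (intro equalityI subsetI)
  fix T assume "T \<in> increasing_trees (Suc 0)"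
  then have d: "distinct (labels T)" "set (labels T) = {1}" by (auto simp: increasing_trees_def)
  obtain l ts where T: "T = Node l ts" by (cases T)
  have "ts = []"
  proof (cases ts)
    case (Cons t ts')
    then show ?thesis using d T label_in_labels[of t] by auto
  qed simp
  then show "T \<in> {Node 1 []}" using d T by auto
qed (auto simp: increasing_trees_def)

section \<open>Statistics of parent-child pairs\<close>

primrec tree_size :: "ptree \<Rightarrow> nat" where
  "tree_size (Node l ts) = Suc (sum_list (map tree_size ts))"

lemma length_labels: "length (labels T) = tree_size T"
  by (induction T) (auto simp: length_concat comp_def intro!: arg_cong[where f=sum_list])

lemma tree_size_pos: "tree_size T \<ge> 1"
  by (cases T) auto

lemma tree_size_graft: "T' \<in> set (graft x T) \<Longrightarrow> tree_size T' = Suc (tree_size T)"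
  using labels_graft(1)[of T' x T] by (metis length_labels size_add_mset size_mset)

lemma tree_size_increasing_trees: "T \<in> increasing_trees n \<Longrightarrow> tree_size T = n"
  using distinct_card[of "labels T"] by (auto simp: increasing_trees_def length_labels)

text \<open>The statistic sums \<open>h a b\<close> over all parent-child pairs with subtree sizes \<open>a\<close> and \<open>b\<close>. In addition a node with \<open>k\<close>
children carries \<open>\<alpha> - (\<alpha> - 1) k\<close>, its attachment rate, as an amount of virtual children of size 0. A new leaf turns
virtual children into a child of size 1, and only with this convention is the family of all these statistics closed
under one step of growth.\<close>

primrec child_stat :: "real \<Rightarrow> (nat \<Rightarrow> nat \<Rightarrow> real) \<Rightarrow> ptree \<Rightarrow> real" where
  "child_stat \<alpha> h (Node l ts) =
     (\<Sum>t\<leftarrow>ts. h (tree_size (Node l ts)) (tree_size t))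
     + (\<alpha> - (\<alpha> - 1) * real (length ts)) * h (tree_size (Node l ts)) 0
     + (\<Sum>t\<leftarrow>ts. child_stat \<alpha> h t)"

lemma child_stat_add:
  "child_stat \<alpha> (\<lambda>a b. h a b + k a b) T = child_stat \<alpha> h T + child_stat \<alpha> k T"
proof (induction T)
  case (Node l ts)
  then have "(\<Sum>t\<leftarrow>ts. child_stat \<alpha> (\<lambda>a b. h a b + k a b) t) =
      (\<Sum>t\<leftarrow>ts. child_stat \<alpha> h t) + (\<Sum>t\<leftarrow>ts. child_stat \<alpha> k t)"
    by (simp add: sum_list_addf[symmetric] cong: map_cong)
  then show ?case by (simp add: sum_list_addf algebra_simps)
qed

lemma child_stat_scale: "child_stat \<alpha> (\<lambda>a b. x * h a b) T = x * child_stat \<alpha> h T"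
proof (induction T)
  case (Node l ts)
  then have "(\<Sum>t\<leftarrow>ts. child_stat \<alpha> (\<lambda>a b. x * h a b) t) = x * (\<Sum>t\<leftarrow>ts. child_stat \<alpha> h t)"
    by (simp add: sum_list_const_mult[symmetric] cong: map_cong)
  then show ?case by (simp add: sum_list_const_mult algebra_simps)
qed

lemma child_stat_zero: "child_stat \<alpha> (\<lambda>a b. 0) T = 0"
  using child_stat_scale[of \<alpha> 0 "\<lambda>_ _. 0" T] by simp

lemma child_stat_sum:
  "finite I \<Longrightarrow> child_stat \<alpha> (\<lambda>a b. \<Sum>i\<in>I. h i a b) T = (\<Sum>i\<in>I. child_stat \<alpha> (h i) T)"
  by (induction I rule: finite_induct) (simp_all add: child_stat_zero child_stat_add)

lemma child_stat_cong:
  "(\<And>a b. a \<ge> 1 \<Longrightarrow> a \<le> tree_size T \<Longrightarrow> h a b = k a b) \<Longrightarrow> child_stat \<alpha> h T = child_stat \<alpha> k T"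
proof (induction T)
  case (Node l ts)
  have "child_stat \<alpha> h t = child_stat \<alpha> k t" if t: "t \<in> set ts" for t
  proof -
    have "tree_size t \<le> sum_list (map tree_size ts)" using t by (intro member_le_sum_list) auto
    then show ?thesis using Node.IH[OF t] Node.prems by (auto simp: le_SucI)
  qed
  then show ?case using Node.prems by (auto cong: map_cong)
qed

text \<open>The common computation behind one step of growth at a node with the subtrees \<open>ts\<close>: either the leaf becomes a further
child, in \<open>length ts + 1\<close> places, or it goes into one of the subtrees. The function \<open>p\<close> stands for the dependence of the
weight of the node on its degree, \<open>\<rho>\<close> for an additional summand depending on the degree. Both have to be arbitrary
for the induction, since fixing the first subtree shifts the argument of \<open>p\<close> and adds a constant to \<open>\<rho>\<close>.\<close>

lemma sum_graft_forest:
  fixes w f u v :: "ptree \<Rightarrow> real" and p \<rho> :: "nat \<Rightarrow> real"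
  assumes "\<And>t. t \<in> set ts \<Longrightarrow> (\<Sum>t'\<leftarrow>graft x t. w t') = u t * w t"
    and "\<And>t. t \<in> set ts \<Longrightarrow> (\<Sum>t'\<leftarrow>graft x t. w t' * f t') = v t * w t"
  shows "(\<Sum>us\<leftarrow>graft_forest x ts. p (length us) * prod_list (map w us) * (\<rho> (length us) + sum_list (map f us))) =
    prod_list (map w ts) *
     (real (Suc (length ts)) * p (Suc (length ts)) * w (Node x []) *
        (\<rho> (Suc (length ts)) + f (Node x []) + sum_list (map f ts))
      + p (length ts) * (sum_list (map v ts) + sum_list (map u ts) * (\<rho> (length ts) + sum_list (map f ts))
          - (\<Sum>t\<leftarrow>ts. u t * f t)))"
  using assms
proof (induction ts arbitrary: p \<rho>)
  case Nil
  then show ?case by simp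
next
  case (Cons t ts)
  let ?k = "length ts" and ?W = "prod_list (map w ts)" and ?F = "sum_list (map f ts)"
  have IH: "(\<Sum>us\<leftarrow>graft_forest x ts. p (Suc (length us)) * prod_list (map w us) *
        (\<rho> (Suc (length us)) + f t + sum_list (map f us))) =
    ?W * (real (Suc ?k) * p (Suc (Suc ?k)) * w (Node x []) * (\<rho> (Suc (Suc ?k)) + f t + f (Node x []) + ?F)
      + p (Suc ?k) * (sum_list (map v ts) + sum_list (map u ts) * (\<rho> (Suc ?k) + f t + ?F)
          - (\<Sum>t\<leftarrow>ts. u t * f t)))"
    using Cons.IH[of "\<lambda>i. p (Suc i)" "\<lambda>i. \<rho> (Suc i) + f t"] Cons.prems by simp
  have third: "(\<Sum>us\<leftarrow>graft_forest x ts. p (Suc (length us)) * (w t * prod_list (map w us)) *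
        (\<rho> (Suc (length us)) + (f t + sum_list (map f us)))) = w t *
      (\<Sum>us\<leftarrow>graft_forest x ts. p (Suc (length us)) * prod_list (map w us) *
        (\<rho> (Suc (length us)) + f t + sum_list (map f us)))"
    by (subst sum_list_const_mult[symmetric]) (simp add: algebra_simps)
  have "(\<Sum>t'\<leftarrow>graft x t. p (Suc ?k) * (w t' * ?W) * (\<rho> (Suc ?k) + (f t' + ?F))) =
      (\<Sum>t'\<leftarrow>graft x t. p (Suc ?k) * ?W * (w t' * f t') + p (Suc ?k) * ?W * (\<rho> (Suc ?k) + ?F) * w t')"
    by (simp add: algebra_simps)
  also have "\<dots> = p (Suc ?k) * ?W * (v t * w t) + p (Suc ?k) * ?W * (\<rho> (Suc ?k) + ?F) * (u t * w t)"
    using Cons.prems by (simp add: sum_list_addf sum_list_const_mult)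
  finally have second: "(\<Sum>t'\<leftarrow>graft x t. p (Suc ?k) * (w t' * ?W) * (\<rho> (Suc ?k) + (f t' + ?F))) = \<dots>" .
  show ?case
    by (simp add: comp_def second third IH) (simp add: algebra_simps)
qed

section \<open>Expected number of parent-child pairs of given sizes\<close>

text \<open>The coefficient of \<open>z ^ (m - 1)\<close> in \<open>(1 - z) powr (- \<alpha>)\<close>; up to a power of \<open>c1\<close> it is \<open>m\<close> times the coefficient of
\<open>z ^ m\<close> in the exponential generating function of the total weights. It grows like \<open>m powr (\<alpha> - 1)\<close>.\<close>

definition growth_ratio :: "real \<Rightarrow> nat \<Rightarrow> real" where
  "growth_ratio \<alpha> m = pochhammer \<alpha> (m - 1) / fact (m - 1)"

locale very_simple_trees =
  fixes c1 c2 \<alpha> :: real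
  assumes admissible: "admissible c1 c2" and alpha_eq: "\<alpha> = 1 + c2 / c1"
begin

lemma c1_pos: "c1 > 0"
  using admissible by (simp add: admissible_def)

lemma alpha_pos: "\<alpha> > 0"
  using admissible by (auto simp: admissible_def Let_def alpha_eq)

lemma alpha_le_2: "\<alpha> \<le> 2"
proof -
  consider "\<alpha> \<le> 1" | d :: nat where "d \<ge> 2" "\<alpha> = real d / (real d - 1)"
    using admissible unfolding admissible_def Let_def alpha_eq by fastforce
  then show ?thesis
  proof cases
    case 2
    show ?thesis unfolding 2(2) using 2(1) by (simp add: field_simps)
  qed simp
qed

text \<open>Apart from \<open>\<phi>\<^sub>0 = 1\<close>, this is the only property of the degree weights that matters: a node of outdegree \<open>k\<close> receives the next leaf at a rate
linear in \<open>k\<close>. It is what singles out the very simple families.\<close>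

lemma phi_coeff_Suc:
  "real (Suc k) * phi_coeff c1 c2 (Suc k) = c1 * (\<alpha> - (\<alpha> - 1) * real k) * phi_coeff c1 c2 k"
proof (cases "c2 = 0")
  case True
  have "real (Suc k) * (c1 ^ Suc k / fact (Suc k)) = c1 * (c1 ^ k / fact k)"
    unfolding fact_Suc by (simp del: of_nat_Suc)
  then show ?thesis using True by (simp add: alpha_eq phi_coeff_exp del: fact_Suc)
next
  case False
  let ?b = "1 + c1 / c2"
  have "real (Suc k) * (?b gchoose Suc k) = (?b - real k) * (?b gchoose k)"
    using gbinomial_mult_1[of ?b k] by (simp add: algebra_simps)
  then have "real (Suc k) * phi_coeff c1 c2 (Suc k) = (?b - real k) * c2 * phi_coeff c1 c2 k"
    using False by (simp add: phi_coeff_powr)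
  also have "(?b - real k) * c2 = c1 * (\<alpha> - (\<alpha> - 1) * real k)"
    using False c1_pos by (simp add: alpha_eq field_simps)
  finally show ?thesis .
qed

lemma weight_leaf: "weight c1 c2 (Node x []) = 1"
  by (simp add: phi_coeff_def phi_def)

lemma real_tree_size: "real (tree_size (Node l ts)) = 1 + (\<Sum>t\<leftarrow>ts. real (tree_size t))"
  by (induction ts) auto

text \<open>The total attachment rate of a tree depends on its size only, because \<open>n\<close> nodes have \<open>n - 1\<close> children altogether:
\<open>n \<alpha> - (n - 1) (\<alpha> - 1) = n + \<alpha> - 1\<close>.\<close>

lemma sum_weight_graft:
  "(\<Sum>T'\<leftarrow>graft x T. weight c1 c2 T') = c1 * (real (tree_size T) + \<alpha> - 1) * weight c1 c2 T"
proof (induction T)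
  case (Node l ts)
  let ?k = "length ts" and ?W = "prod_list (map (weight c1 c2) ts)"
  have U: "(\<Sum>t\<leftarrow>ts. c1 * (real (tree_size t) + \<alpha> - 1)) =
      c1 * (real (tree_size (Node l ts)) - 1 + (\<alpha> - 1) * real ?k)"
    unfolding real_tree_size by (induction ts) (auto simp: algebra_simps)
  have "(\<Sum>T'\<leftarrow>graft x (Node l ts). weight c1 c2 T') =
      (\<Sum>us\<leftarrow>graft_forest x ts. phi_coeff c1 c2 (length us) * prod_list (map (weight c1 c2) us)
         * (1 + sum_list (map (\<lambda>_. 0) us)))"
    by (simp add: comp_def)
  also have "\<dots> = ?W * (real (Suc ?k) * phi_coeff c1 c2 (Suc ?k)
       + phi_coeff c1 c2 ?k * (\<Sum>t\<leftarrow>ts. c1 * (real (tree_size t) + \<alpha> - 1)))"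
    using Node by (subst sum_graft_forest[where u = "\<lambda>t. c1 * (real (tree_size t) + \<alpha> - 1)" and v = "\<lambda>_. 0"])
      (auto simp: weight_leaf simp del: weight.simps)
  also have "\<dots> = c1 * (real (tree_size (Node l ts)) + \<alpha> - 1) * weight c1 c2 (Node l ts)"
    unfolding phi_coeff_Suc U by (simp add: algebra_simps)
  finally show ?case .
qed

text \<open>The rate at which a child of size \<open>b\<close> receives the next leaf. An amount \<open>r\<close> of virtual children is hit at rate \<open>r\<close>, so the
rate per unit is 1.\<close>

definition attach_rate :: "nat \<Rightarrow> real" where
  "attach_rate b = (if b = 0 then 1 else real b + \<alpha> - 1)"

text \<open>The generator of the growth process on pair statistics. At a pair \<open>(a, b)\<close> the leaf lands below the parent but outside the
child, or inside the child, at rates \<open>a - b\<close> and \<open>attach_rate b\<close>. It lands outside the parent at rate \<open>n - a\<close>; the part \<open>n\<close>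
is split off because it is the same for all pairs.\<close>

definition grow :: "(nat \<Rightarrow> nat \<Rightarrow> real) \<Rightarrow> nat \<Rightarrow> nat \<Rightarrow> real" where
  "grow h a b = (real a - real b) * h (Suc a) b + attach_rate b * h (Suc a) (Suc b) - real a * h a b"

text \<open>The subtle point is a leaf attached to the node itself, where the amount \<open>r\<close> of virtual children drops to \<open>r - (\<alpha> - 1)\<close>.
Together with leaves landing strictly below the node, which leave \<open>r\<close> alone, this gives
\<open>r (r - (\<alpha> - 1)) + r (a + \<alpha> - 1 - r) = r a\<close>: the terms quadratic in \<open>r\<close> cancel, and a virtual child behaves like a
child of size 0. The summand with \<open>h 1 0\<close> accounts for the virtual children of the new leaf.\<close>

lemma sum_child_stat_graft:
  "(\<Sum>T'\<leftarrow>graft x T. weight c1 c2 T' * child_stat \<alpha> h T') =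
     c1 * weight c1 c2 T * (child_stat \<alpha> (grow h) T + real (tree_size T) * child_stat \<alpha> h T
       + \<alpha> * (real (tree_size T) + \<alpha> - 1) * h 1 0)"
proof (induction T)
  case (Node l ts)
  define S where "S = tree_size (Node l ts)"
  define r where "r = \<alpha> - (\<alpha> - 1) * real (length ts)"
  let ?k = "length ts" and ?W = "prod_list (map (weight c1 c2) ts)" and ?F = "child_stat \<alpha>"
  let ?f = "\<lambda>t. h (Suc S) (tree_size t) + ?F h t"
  let ?u = "\<lambda>t. c1 * (real (tree_size t) + \<alpha> - 1)"
  \<comment> \<open>What the induction hypothesis gives for \<open>?f\<close>, when the leaf goes into the subtree \<open>t\<close>.\<close>
  let ?v = "\<lambda>t. c1 * ((real (tree_size t) + \<alpha> - 1) * h (Suc S) (Suc (tree_size t)) + ?F (grow h) t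
      + real (tree_size t) * ?F h t + \<alpha> * (real (tree_size t) + \<alpha> - 1) * h 1 0)"
  let ?\<rho> = "\<lambda>k. (\<alpha> - (\<alpha> - 1) * real k) * h (Suc S) 0"
  \<comment> \<open>All grafted trees have the same size, so \<open>h\<close> is evaluated at \<open>Suc S\<close> for the root.\<close>
  have S: "tree_size (Node l us) = Suc S" if "us \<in> set (graft_forest x ts)" for us
    using that tree_size_graft[of "Node l us" x "Node l ts"] by (auto simp: S_def)
  have rate: "attach_rate (tree_size t) = real (tree_size t) + \<alpha> - 1" for t
    using tree_size_pos[of t] by (simp add: attach_rate_def)
  have v: "(\<Sum>t'\<leftarrow>graft x t. weight c1 c2 t' * ?f t') = ?v t * weight c1 c2 t" if "t \<in> set ts" for t
  proof -
    have "(\<Sum>t'\<leftarrow>graft x t. weight c1 c2 t' * ?f t') =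
        (\<Sum>t'\<leftarrow>graft x t. h (Suc S) (Suc (tree_size t)) * weight c1 c2 t' + weight c1 c2 t' * ?F h t')"
      by (intro arg_cong[where f = sum_list] map_cong refl) (simp add: tree_size_graft algebra_simps)
    also have "\<dots> = ?v t * weight c1 c2 t"
      unfolding sum_list_addf sum_list_const_mult sum_weight_graft Node[OF that]
      by (simp add: algebra_simps)
    finally show ?thesis .
  qed
  have "(\<Sum>T'\<leftarrow>graft x (Node l ts). weight c1 c2 T' * ?F h T') =
     (\<Sum>us\<leftarrow>graft_forest x ts. phi_coeff c1 c2 (length us) * prod_list (map (weight c1 c2) us)
        * (?\<rho> (length us) + sum_list (map ?f us)))"
    unfolding graft.simps map_map comp_def
    by (intro arg_cong[where f = sum_list] map_cong refl)
      (simp only: child_stat.simps S weight.simps, simp add: sum_list_addf)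
  also have "\<dots> = ?W * (real (Suc ?k) * phi_coeff c1 c2 (Suc ?k) * (?\<rho> (Suc ?k) + (h (Suc S) 1 + \<alpha> * h 1 0) + sum_list (map ?f ts))
      + phi_coeff c1 c2 ?k * (sum_list (map ?v ts) + sum_list (map ?u ts) * (?\<rho> ?k + sum_list (map ?f ts))
          - (\<Sum>t\<leftarrow>ts. ?u t * ?f t)))"
    by (subst sum_graft_forest[where u = ?u and v = ?v, OF sum_weight_graft v])
      (simp_all add: weight_leaf del: weight.simps)
  also have "\<dots> = ?W * phi_coeff c1 c2 ?k * (c1 * r * ((r - (\<alpha> - 1)) * h (Suc S) 0 + h (Suc S) 1 + \<alpha> * h 1 0)
      + sum_list (map ?u ts) * (r * h (Suc S) 0)
      + (sum_list (map ?v ts) - (\<Sum>t\<leftarrow>ts. ?u t * ?f t) + (c1 * r + sum_list (map ?u ts)) * sum_list (map ?f ts)))"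
    unfolding phi_coeff_Suc r_def by (simp add: algebra_simps)
  also have U: "sum_list (map ?u ts) = c1 * (real S + \<alpha> - 1 - r)"
    unfolding S_def r_def real_tree_size by (induction ts) (auto simp: algebra_simps)
  also have "sum_list (map ?v ts) - (\<Sum>t\<leftarrow>ts. ?u t * ?f t) + (c1 * r + c1 * (real S + \<alpha> - 1 - r)) * sum_list (map ?f ts)
     = (\<Sum>t\<leftarrow>ts. ?v t - ?u t * ?f t + c1 * (real S + \<alpha> - 1) * ?f t)"
    by (simp add: sum_list_addf sum_list_subtractf sum_list_const_mult algebra_simps)
  also have "\<dots> = (\<Sum>t\<leftarrow>ts. c1 * (grow h S (tree_size t)) + c1 * real S * h S (tree_size t) + c1 * ?F (grow h) t
      + c1 * real S * ?F h t + \<alpha> * h 1 0 * ?u t)"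
    by (intro arg_cong[where f = sum_list] map_cong refl)
      (simp add: grow_def rate algebra_simps)
  also have "\<dots> = c1 * (\<Sum>t\<leftarrow>ts. grow h S (tree_size t)) + c1 * real S * (\<Sum>t\<leftarrow>ts. h S (tree_size t))
      + c1 * (\<Sum>t\<leftarrow>ts. ?F (grow h) t) + c1 * real S * (\<Sum>t\<leftarrow>ts. ?F h t)
      + \<alpha> * h 1 0 * (c1 * (real S + \<alpha> - 1 - r))"
    unfolding sum_list_addf sum_list_const_mult U[symmetric] by (simp add: sum_list_const_mult)
  finally show ?case
    unfolding child_stat.simps S_def[symmetric] r_def[symmetric] weight.simps
    by (simp add: grow_def attach_rate_def algebra_simps)
qed

definition total_weight :: "nat \<Rightarrow> real" where
  "total_weight n = (\<Sum>T\<in>increasing_trees n. weight c1 c2 T)"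

definition child_total :: "nat \<Rightarrow> (nat \<Rightarrow> nat \<Rightarrow> real) \<Rightarrow> real" where
  "child_total n h = (\<Sum>T\<in>increasing_trees n. weight c1 c2 T * child_stat \<alpha> h T)"

lemma child_total_add:
  "child_total n (\<lambda>a b. h a b + k a b) = child_total n h + child_total n k"
  by (simp add: child_total_def child_stat_add distrib_left sum.distrib)

lemma child_total_scale: "child_total n (\<lambda>a b. x * h a b) = x * child_total n h"
  by (simp add: child_total_def child_stat_scale sum_distrib_left algebra_simps)

lemma child_total_sum:
  "finite I \<Longrightarrow> child_total n (\<lambda>a b. \<Sum>i\<in>I. h i a b) = (\<Sum>i\<in>I. child_total n (h i))"
  by (simp add: child_total_def child_stat_sum sum_distrib_left) (rule sum.swap)

lemma total_weight_1: "total_weight 1 = 1"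
  by (simp add: total_weight_def increasing_trees_1 weight_leaf del: weight.simps)

lemma total_weight_Suc:
  assumes "n \<ge> 1"
  shows "total_weight (Suc n) = c1 * (real n + \<alpha> - 1) * total_weight n"
  unfolding total_weight_def sum_increasing_trees_Suc[OF assms] sum_weight_graft
  by (simp add: sum_distrib_left tree_size_increasing_trees)

lemma total_weight_pos: "n \<ge> 1 \<Longrightarrow> total_weight n > 0"
proof (induction n rule: nat_induct_at_least)
  case base
  then show ?case using total_weight_1 by simp
next
  case (Suc n)
  then show ?case using c1_pos alpha_pos by (auto simp: total_weight_Suc intro!: mult_pos_pos)
qed

lemma child_total_Suc:
  assumes "n \<ge> 1"
  shows "child_total (Suc n) h = c1 * (child_total n (grow h) + real n * child_total n h
    + \<alpha> * (real n + \<alpha> - 1) * total_weight n * h 1 0)"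
proof -
  have "child_total (Suc n) h = (\<Sum>T\<in>increasing_trees n. c1 * weight c1 c2 T *
      (child_stat \<alpha> (grow h) T + real n * child_stat \<alpha> h T + \<alpha> * (real n + \<alpha> - 1) * h 1 0))"
    unfolding child_total_def sum_increasing_trees_Suc[OF assms] sum_child_stat_graft
    by (intro sum.cong) (auto simp: tree_size_increasing_trees)
  also have "\<dots> = c1 * (child_total n (grow h) + real n * child_total n h
    + \<alpha> * (real n + \<alpha> - 1) * total_weight n * h 1 0)"
    by (simp add: child_total_def total_weight_def sum_distrib_left sum.distrib[symmetric] algebra_simps)
  finally show ?thesis .
qed

lemma growth_ratio_1: "growth_ratio \<alpha> (Suc 0) = 1"
  by (simp add: growth_ratio_def)

lemma growth_ratio_Suc:
  assumes "m \<ge> 1"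
  shows "real m * growth_ratio \<alpha> (Suc m) = (real m + \<alpha> - 1) * growth_ratio \<alpha> m"
proof (cases m)
  case (Suc k)
  have "real (Suc k) * (pochhammer \<alpha> k * (\<alpha> + real k) / (real (Suc k) * fact k)) =
      (\<alpha> + real k) * (pochhammer \<alpha> k / fact k)"
    by (simp del: of_nat_Suc)
  then show ?thesis using Suc by (simp add: growth_ratio_def pochhammer_Suc algebra_simps)
qed (use assms in simp)

lemma growth_ratio_pos: "growth_ratio \<alpha> m > 0"
  using alpha_pos by (simp add: growth_ratio_def pochhammer_pos)

text \<open>The expected number of children of the root with subtree size \<open>j\<close> in a random tree of size \<open>m\<close>, for \<open>j < m\<close>; for \<open>j = 0\<close>
the expected amount of virtual children.\<close>

definition child_mean :: "nat \<Rightarrow> nat \<Rightarrow> real" where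
  "child_mean m j = \<alpha> * (if j = 0 then 1 else growth_ratio \<alpha> j / real j) / growth_ratio \<alpha> m"

text \<open>The expected number of nodes with subtree size \<open>m\<close> in a random tree of size \<open>n\<close>, for \<open>1 \<le> m \<le> n\<close>.\<close>

definition subtree_mean :: "nat \<Rightarrow> nat \<Rightarrow> real" where
  "subtree_mean n m = (if m = n then 1
     else \<alpha> * (real n + \<alpha> - 1) / ((real m + \<alpha> - 1) * (real m + \<alpha>)))"

text \<open>Given its size, a subtree is again a random tree of the same family, which explains the product form. The product is not
derived from this observation, but verified to solve the recursion of the growth process.\<close>

definition edge_mean :: "nat \<Rightarrow> nat \<Rightarrow> nat \<Rightarrow> real" where
  "edge_mean n m j = (if j < m \<and> m \<le> n then subtree_mean n m * child_mean m j else 0)"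

lemma child_mean_Suc:
  assumes "m \<ge> 1"
  shows "real m * child_mean m j = (real m + \<alpha> - 1) * child_mean (Suc m) j"
proof -
  have "growth_ratio \<alpha> m / real m = growth_ratio \<alpha> (Suc m) / (real m + \<alpha> - 1)"
    using growth_ratio_Suc[OF assms] assms alpha_pos by (simp add: field_simps)
  then show ?thesis
    using growth_ratio_Suc[OF assms] growth_ratio_pos[of m] growth_ratio_pos[of "Suc m"] assms alpha_pos
    by (simp add: child_mean_def divide_simps)
qed

text \<open>In terms of the numerators of \<open>child_mean\<close>, subtrees of size \<open>j + 1\<close> come from those of size \<open>j\<close>; virtual children, \<open>j = 0\<close>,
obey the same rule.\<close>

lemma child_mean_attach: "attach_rate j * child_mean m j = real (Suc j) * child_mean m (Suc j)"
proof -
  have "attach_rate j * (if j = 0 then 1 else growth_ratio \<alpha> j / real j) = growth_ratio \<alpha> (Suc j)"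
    using growth_ratio_Suc[of j] by (auto simp: attach_rate_def growth_ratio_1 field_simps)
  moreover have "real (Suc j) * (growth_ratio \<alpha> (Suc j) / real (Suc j)) = growth_ratio \<alpha> (Suc j)"
    by simp
  ultimately show ?thesis
    unfolding child_mean_def times_divide_eq_right mult.left_commute[of _ \<alpha>] by simp
qed

lemma subtree_mean_Suc:
  assumes "m \<ge> 1" "m \<le> n"
  shows "(real n + \<alpha> - 1) * subtree_mean (Suc n) (Suc m) =
    (if Suc m \<le> n then (real n - real (Suc m)) * subtree_mean n (Suc m) else 0)
      + (real m + \<alpha> - 1) * subtree_mean n m"
proof -
  have p: "real m + \<alpha> - 1 > 0" "real m + \<alpha> > 0" "real m + \<alpha> + 1 > 0" using assms alpha_pos by auto
  consider "m = n" | "Suc m = n" | "Suc m < n" using assms by linarith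
  then show ?thesis
    using p by cases (auto simp: subtree_mean_def divide_simps, algebra+)
qed

lemma subtree_mean_1:
  assumes "n \<ge> 1"
  shows "(real n + \<alpha> - 1) * subtree_mean (Suc n) 1 = (real n - 1) * subtree_mean n 1 + (real n + \<alpha> - 1)"
proof -
  have 1: "subtree_mean (Suc n) 1 = (real n + \<alpha>) / (1 + \<alpha>)"
    using assms alpha_pos by (simp add: subtree_mean_def)
  have 2: "(real n - 1) * subtree_mean n 1 = (real n - 1) * ((real n + \<alpha> - 1) / (1 + \<alpha>))"
    using alpha_pos by (auto simp: subtree_mean_def)
  show ?thesis unfolding 1 2 using alpha_pos by (simp add: field_simps)
qed

definition at_pair :: "nat \<Rightarrow> nat \<Rightarrow> nat \<Rightarrow> nat \<Rightarrow> real" where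
  "at_pair m j a b = (if a = m \<and> b = j then 1 else 0)"

text \<open>The two contributions from parents of size \<open>m\<close> add up to \<open>subtree_mean n m * (m * child_mean m j)\<close>: by
\<open>child_mean_attach\<close> the growing children supply \<open>j\<close>, and the rest of the subtree supplies \<open>m - j\<close>. This reduces the
recursion in two variables to the one for \<open>subtree_mean\<close>.\<close>

lemma edge_mean_Suc:
  assumes "n \<ge> 1"
  shows "(real n + \<alpha> - 1) * edge_mean (Suc n) (Suc m) j =
    (real m - real j) * edge_mean n m j
    + (case j of 0 \<Rightarrow> 0 | Suc i \<Rightarrow> attach_rate i * edge_mean n m i)
    + (real n - real (Suc m)) * edge_mean n (Suc m) j
    + (if m = 0 \<and> j = 0 then \<alpha> * (real n + \<alpha> - 1) else 0)"
proof (cases "m \<ge> 1 \<and> m \<le> n \<and> j \<le> m")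
  case True
  then have m: "m \<ge> 1" "m \<le> n" "j \<le> m" by auto
  have "(real m - real j) * edge_mean n m j = (real m - real j) * (subtree_mean n m * child_mean m j)"
    using m by (auto simp: edge_mean_def)
  moreover have "(case j of 0 \<Rightarrow> 0 | Suc i \<Rightarrow> attach_rate i * edge_mean n m i) =
      subtree_mean n m * (real j * child_mean m j)"
  proof (cases j)
    case (Suc i)
    then show ?thesis using m child_mean_attach[of i m] by (auto simp: edge_mean_def)
  qed simp
  ultimately have "(real m - real j) * edge_mean n m j
      + (case j of 0 \<Rightarrow> 0 | Suc i \<Rightarrow> attach_rate i * edge_mean n m i) = subtree_mean n m * (real m * child_mean m j)"
    by (simp add: algebra_simps)
  also have "\<dots> = (real m + \<alpha> - 1) * subtree_mean n m * child_mean (Suc m) j"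
    unfolding child_mean_Suc[OF m(1)] by simp
  moreover have "(real n + \<alpha> - 1) * edge_mean (Suc n) (Suc m) j =
      ((real n + \<alpha> - 1) * subtree_mean (Suc n) (Suc m)) * child_mean (Suc m) j"
    using m by (simp add: edge_mean_def)
  ultimately show ?thesis
    unfolding subtree_mean_Suc[OF m(1,2)] using m by (auto simp: edge_mean_def algebra_simps)
next
  case False
  show ?thesis
  proof (cases "m = 0 \<and> j = 0")
    case True
    have "edge_mean k 1 0 = \<alpha> * subtree_mean k 1" if "k \<ge> 1" for k
      using that by (simp add: edge_mean_def child_mean_def growth_ratio_1)
    then have "(real n + \<alpha> - 1) * edge_mean (Suc n) 1 0 =
        (real n - 1) * edge_mean n 1 0 + \<alpha> * (real n + \<alpha> - 1)"
      using arg_cong[OF subtree_mean_1[OF assms], of "\<lambda>x. \<alpha> * x"] assms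
      by (simp add: distrib_left mult.left_commute)
    then show ?thesis using True by (simp add: edge_mean_def)
  next
    case F: False
    then show ?thesis using False by (auto simp: edge_mean_def split: nat.split)
  qed
qed

lemma grow_at_pair:
  "grow (at_pair (Suc m) j) = (\<lambda>a b. (real m - real j) * at_pair m j a b
     + ((case j of 0 \<Rightarrow> 0 | Suc i \<Rightarrow> attach_rate i * at_pair m i a b)
     + (- real (Suc m)) * at_pair (Suc m) j a b))"
  by (auto simp: fun_eq_iff grow_def at_pair_def split: nat.split)

lemma child_total_at_pair:
  "n \<ge> 1 \<Longrightarrow> child_total n (at_pair m j) = total_weight n * edge_mean n m j"
proof (induction n arbitrary: m j rule: nat_induct_at_least)
  case base
  show ?case unfolding total_weight_1 child_total_def
    by (auto simp: increasing_trees_1 weight_leaf at_pair_def edge_mean_def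
      subtree_mean_def child_mean_def growth_ratio_1 simp del: weight.simps)
next
  case (Suc n)
  show ?case
  proof (cases m)
    case 0
    have "child_stat \<alpha> (at_pair 0 j) T = child_stat \<alpha> (\<lambda>_ _. 0) T" for T
      by (rule child_stat_cong) (auto simp: at_pair_def)
    then show ?thesis using 0 by (simp add: child_total_def child_stat_zero edge_mean_def)
  next
    case (Suc m')
    have c: "child_total n (\<lambda>a b. case j of 0 \<Rightarrow> 0 | Suc i \<Rightarrow> attach_rate i * at_pair m' i a b) =
       total_weight n * (case j of 0 \<Rightarrow> 0 | Suc i \<Rightarrow> attach_rate i * edge_mean n m' i)"
    proof (cases j)
      case 0
      then show ?thesis using child_total_scale[of n 0 "\<lambda>_ _. 0"] by simp
    next
      case (Suc i)
      then show ?thesis by (simp add: child_total_scale Suc.IH)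
    qed
    have g: "child_total n (grow (at_pair m j)) = total_weight n * ((real m' - real j) * edge_mean n m' j
        + (case j of 0 \<Rightarrow> 0 | Suc i \<Rightarrow> attach_rate i * edge_mean n m' i) - real (Suc m') * edge_mean n m j)"
      unfolding \<open>m = Suc m'\<close> grow_at_pair child_total_add child_total_scale c Suc.IH
      by (simp add: algebra_simps)
    have "child_total (Suc n) (at_pair m j) = c1 * total_weight n *
        ((real m' - real j) * edge_mean n m' j
          + (case j of 0 \<Rightarrow> 0 | Suc i \<Rightarrow> attach_rate i * edge_mean n m' i)
          + (real n - real (Suc m')) * edge_mean n (Suc m') j
          + (if m' = 0 \<and> j = 0 then \<alpha> * (real n + \<alpha> - 1) else 0))"
      unfolding child_total_Suc[OF Suc.hyps] g Suc.IH unfolding \<open>m = Suc m'\<close>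
      by (auto simp: at_pair_def algebra_simps)
    also have "\<dots> = c1 * total_weight n * ((real n + \<alpha> - 1) * edge_mean (Suc n) m j)"
      unfolding edge_mean_Suc[OF Suc.hyps, symmetric] \<open>m = Suc m'\<close> ..
    also have "\<dots> = total_weight (Suc n) * edge_mean (Suc n) m j"
      unfolding total_weight_Suc[OF Suc.hyps] by simp
    finally show ?thesis .
  qed
qed

end

section \<open>The centroid as the end of the heavy path\<close>

primrec subtrees :: "ptree \<Rightarrow> ptree set" where
  "subtrees (Node l ts) = insert (Node l ts) (\<Union> (set (map subtrees ts)))"

lemma subtree_refl: "T \<in> subtrees T"
  by (cases T) auto

lemma subtree_child: "t \<in> set (children s) \<Longrightarrow> t \<in> subtrees s"
  using subtree_refl by (cases s) auto

lemma subtree_trans: "s \<in> subtrees T \<Longrightarrow> subtrees s \<subseteq> subtrees T"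
  by (induction T) auto

lemma subtree_cases:
  assumes "s \<in> subtrees T"
  obtains "s = T" | t where "t \<in> set (children T)" "s \<in> subtrees t"
  using assms by (cases T) auto

lemma subtree_parent:
  assumes "s \<in> subtrees T" "s \<noteq> T"
  obtains p where "p \<in> subtrees T" "s \<in> set (children p)"
proof -
  have "\<exists>p\<in>subtrees T. s \<in> set (children p)"
    using assms
  proof (induction T)
    case (Node l ts)
    then obtain t where t: "t \<in> set ts" "s \<in> subtrees t" by auto
    show ?case
    proof (cases "s = t")
      case True
      then show ?thesis using t by auto
    next
      case False
      then show ?thesis using Node.IH[OF t] t(1) by auto
    qed
  qed
  then show ?thesis using that by blast
qed

lemma set_labels: "set (labels T) = label ` subtrees T"
  by (induction T) auto

lemma label_subtree: "s \<in> subtrees T \<Longrightarrow> label s \<in> set (labels T)"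
  by (auto simp: set_labels)

lemma labels_subtree: "s \<in> subtrees T \<Longrightarrow> set (labels s) \<subseteq> set (labels T)"
  unfolding set_labels using subtree_trans by blast

lemma distinct_subtree: "s \<in> subtrees T \<Longrightarrow> distinct (labels T) \<Longrightarrow> distinct (labels s)"
  by (induction T) (auto simp: distinct_concat_iff)

lemma size_child: "t \<in> set (children s) \<Longrightarrow> tree_size t < tree_size s"
  by (cases s) (auto simp: less_Suc_eq_le intro!: member_le_sum_list)

lemma size_subtree: "s \<in> subtrees T \<Longrightarrow> tree_size s \<le> tree_size T"
proof (induction T)
  case (Node l ts)
  show ?case
  proof (cases "s = Node l ts")
    case False
    then obtain t where "t \<in> set ts" "s \<in> subtrees t" using Node.prems by auto
    then show ?thesis using Node.IH[of t] size_child[of t "Node l ts"] by simp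
  qed simp
qed

lemma size_siblings:
  "t \<in> set ts \<Longrightarrow> t' \<in> set ts \<Longrightarrow> t \<noteq> t' \<Longrightarrow>
     tree_size t + tree_size t' \<le> sum_list (map tree_size ts)"
proof (induction ts)
  case (Cons a ts)
  have m: "tree_size u \<le> sum_list (map tree_size ts)" if "u \<in> set ts" for u
    using that by (intro member_le_sum_list) auto
  show ?case using Cons m[of t] m[of t'] by auto
qed simp

lemma size_proper_subtree: "s \<in> subtrees T \<Longrightarrow> s \<noteq> T \<Longrightarrow> tree_size s < tree_size T"
  using subtree_parent[of s T] size_child size_subtree by (metis order_less_le_trans)

lemma edges_iff: "(a, b) \<in> edges T \<longleftrightarrow>
    (\<exists>s\<in>subtrees T. \<exists>t\<in>set (children s). a = label s \<and> b = label t)"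
  by (induction T) auto

lemma sibling_unique:
  "distinct (concat (map labels ts)) \<Longrightarrow> t \<in> set ts \<Longrightarrow> t' \<in> set ts \<Longrightarrow>
     x \<in> set (labels t) \<Longrightarrow> x \<in> set (labels t') \<Longrightarrow> t = t'"
  by (induction ts) auto

lemma subtree_unique:
  "distinct (labels T) \<Longrightarrow> s \<in> subtrees T \<Longrightarrow> s' \<in> subtrees T \<Longrightarrow> label s = label s' \<Longrightarrow> s = s'"
proof (induction T)
  case (Node l ts)
  have l: "\<forall>t\<in>set ts. \<forall>u\<in>subtrees t. label u \<noteq> l"
    using Node.prems(1) by (auto simp: set_labels)
  have root: "u = Node l ts" if u: "u \<in> subtrees (Node l ts)" "label u = l" for u
  proof (rule ccontr)
    assume "u \<noteq> Node l ts"
    then obtain t where "t \<in> set ts" "u \<in> subtrees t" using u(1) by auto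
    then show False using l u(2) by blast
  qed
  show ?case
  proof (cases "s = Node l ts \<or> s' = Node l ts")
    case True
    then show ?thesis using root[of s] root[of s'] Node.prems(2-4) by (metis ptree.sel(1))
  next
    case False
    then obtain t t' where t: "t \<in> set ts" "s \<in> subtrees t" "t' \<in> set ts" "s' \<in> subtrees t'"
      using Node.prems by auto
    have "t = t'"
      using Node.prems label_subtree[OF t(2)] label_subtree[OF t(4)] t
      by (intro sibling_unique[of ts t t' "label s"]) auto
    moreover have "distinct (labels t)" using Node.prems(1) t(1) by (auto simp: distinct_concat_iff)
    ultimately show ?thesis using Node.IH[OF t(1)] Node.prems(4) t by auto
  qed
qed

text \<open>Stated for labels of children rather than for the children themselves, as needed when only an edge between labels is
known.\<close>

lemma parent_unique:
  "distinct (labels T) \<Longrightarrow> s \<in> subtrees T \<Longrightarrow> s' \<in> subtrees T \<Longrightarrow>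
     t \<in> set (children s) \<Longrightarrow> t' \<in> set (children s') \<Longrightarrow> label t = label t' \<Longrightarrow> s = s'"
proof (induction T)
  case (Node l ts)
  have dis: "distinct (concat (map labels ts))" using Node.prems(1) by auto
  have root: "s1 = s2"
    if s: "s1 = Node l ts" "s2 \<in> subtrees (Node l ts)" "t1 \<in> set (children s1)" "t2 \<in> set (children s2)"
      and lab: "label t1 = label t2"
    for s1 s2 t1 t2
  proof (rule ccontr)
    assume "s1 \<noteq> s2"
    then obtain u where u: "u \<in> set ts" "s2 \<in> subtrees u" using s by auto
    have t2: "t2 \<in> subtrees u" using subtree_trans[OF u(2)] subtree_child[OF s(4)] by auto
    then have "t1 = u" using s lab u label_in_labels[of t1] label_subtree[OF t2]
      by (intro sibling_unique[OF dis, of _ _ "label t1"]) auto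
    then have "t2 = u"
      using subtree_unique[of u t2 u] t2 lab subtree_refl u(1) dis by (auto simp: distinct_concat_iff)
    then show False using size_child[OF s(4)] size_subtree[OF u(2)] by simp
  qed
  show ?case
  proof (cases "s = Node l ts \<or> s' = Node l ts")
    case True
    then show ?thesis using root[of s s' t t'] root[of s' s t' t] Node.prems by metis
  next
    case False
    then obtain u u' where u: "u \<in> set ts" "s \<in> subtrees u" "u' \<in> set ts" "s' \<in> subtrees u'"
      using Node.prems by auto
    have t: "t \<in> subtrees u" "t' \<in> subtrees u'"
      using subtree_trans[OF u(2)] subtree_trans[OF u(4)] subtree_child Node.prems by blast+
    have "u = u'"
      using u Node.prems(6) label_subtree[OF t(1)] label_subtree[OF t(2)]
      by (intro sibling_unique[OF dis, of _ _ "label t"]) auto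
    moreover have "distinct (labels u)" using dis u(1) by (auto simp: distinct_concat_iff)
    ultimately show ?thesis using Node.IH[OF u(1)] Node.prems u by auto
  qed
qed

lemma edge_stays_below:
  assumes "distinct (labels T)" "c \<in> subtrees T" "(a, b) \<in> edges T" "a \<in> set (labels c)"
  shows "b \<in> set (labels c)"
proof -
  obtain s t where s: "s \<in> subtrees T" "t \<in> set (children s)" "a = label s" "b = label t"
    using assms(3) by (auto simp: edges_iff)
  obtain s' where s': "s' \<in> subtrees c" "a = label s'" using assms(4) by (auto simp: set_labels)
  have "s = s'" using subtree_unique[OF assms(1)] s s' subtree_trans[OF assms(2)] by blast
  then have "t \<in> subtrees c" using subtree_trans[OF s'(1)] subtree_child[OF s(2)] by auto
  then show ?thesis using s by (auto simp: set_labels)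
qed

text \<open>The edge above the root of a subtree is a bridge. Together with \<open>edge_stays_below\<close> this replaces the theory of paths
in trees.\<close>

lemma edge_enters_at_root:
  assumes "distinct (labels T)" "p \<in> subtrees T" "c \<in> set (children p)"
    and "(a, b) \<in> edges T" "a \<notin> set (labels c)" "b \<in> set (labels c)"
  shows "a = label p \<and> b = label c"
proof -
  have c: "c \<in> subtrees T" using subtree_trans[OF assms(2)] subtree_child[OF assms(3)] by auto
  obtain s t where s: "s \<in> subtrees T" "t \<in> set (children s)" "a = label s" "b = label t"
    using assms(4) by (auto simp: edges_iff)
  obtain t' where t': "t' \<in> subtrees c" "b = label t'" using assms(6) by (auto simp: set_labels)
  have "t' = c"
  proof (rule ccontr)
    assume "t' \<noteq> c"
    then obtain q where q: "q \<in> subtrees c" "t' \<in> set (children q)" using subtree_parent[OF t'(1)] by auto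
    then have "s = q"
      using parent_unique[OF assms(1) s(1) _ s(2)] subtree_trans[OF c] t' s(4) by auto
    then show False using q assms(5) s(3) by (auto simp: set_labels)
  qed
  then have "s = p" using parent_unique[OF assms(1) s(1) assms(2) s(2) assms(3)] t' s(4) by simp
  then show ?thesis using s t' \<open>t' = c\<close> by simp
qed

abbreviation adjacent :: "ptree \<Rightarrow> (nat \<times> nat) set" where
  "adjacent T \<equiv> edges T \<union> (edges T)\<inverse>"

lemma walk_reverse: "(x, y) \<in> adjacent T ^^ k \<Longrightarrow> (y, x) \<in> adjacent T ^^ k"
proof (induction k arbitrary: y)
  case (Suc k)
  then obtain z where "(x, z) \<in> adjacent T ^^ k" "(z, y) \<in> adjacent T" by auto
  then show ?case using Suc.IH[of z] relpow_Suc_I2[of y z "adjacent T" x k] by auto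
qed simp

text \<open>The first entrance of the walk into the subtree is through the bridge, and is split off here with what precedes and
what follows it.\<close>

lemma walk_into_subtree:
  assumes "distinct (labels T)" "p \<in> subtrees T" "c \<in> set (children p)"
    and "(x, u) \<in> adjacent T ^^ k" "x \<notin> set (labels c)" "u \<in> set (labels c)"
  shows "\<exists>i j. k = Suc (i + j) \<and> (x, label p) \<in> adjacent T ^^ i \<and> (label c, u) \<in> adjacent T ^^ j"
  using assms(4,5)
proof (induction k arbitrary: x)
  case 0
  then show ?case using assms(6) by simp
next
  case (Suc k)
  have c: "c \<in> subtrees T" using subtree_trans[OF assms(2)] subtree_child[OF assms(3)] by auto
  obtain y where y: "(x, y) \<in> adjacent T" "(y, u) \<in> adjacent T ^^ k"
    using relpow_Suc_D2[OF Suc.prems(1)] by auto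
  show ?case
  proof (cases "y \<in> set (labels c)")
    case True
    then have "(x, y) \<in> edges T"
      using y(1) edge_stays_below[OF assms(1) c, of y x] Suc.prems(2) by auto
    then have "x = label p \<and> y = label c"
      using edge_enters_at_root[OF assms(1-3)] Suc.prems(2) True by blast
    then show ?thesis using y(2) by (intro exI[of _ 0] exI[of _ k]) auto
  next
    case False
    then obtain i j where "k = Suc (i + j)" "(y, label p) \<in> adjacent T ^^ i" "(label c, u) \<in> adjacent T ^^ j"
      using Suc.IH[OF y(2)] by auto
    then show ?thesis using relpow_Suc_I2[OF y(1)] by (intro exI[of _ "Suc i"] exI[of _ j]) auto
  qed
qed

lemma descendants_subset: "s \<in> subtrees T \<Longrightarrow> w \<in> set (labels s) \<Longrightarrow> (label s, w) \<in> (edges T)\<^sup>*"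
proof (induction s)
  case (Node l ts)
  show ?case
  proof (cases "w = l")
    case False
    then obtain t where t: "t \<in> set ts" "w \<in> set (labels t)" using Node.prems by auto
    have "t \<in> subtrees T" using subtree_trans[OF Node.prems(1)] subtree_child[of t "Node l ts"] t by auto
    moreover have "(l, label t) \<in> edges T" using Node.prems(1) t(1) by (force simp: edges_iff)
    ultimately show ?thesis using Node.IH[OF t(1) _ t(2)] by (simp add: converse_rtrancl_into_rtrancl)
  qed simp
qed

lemma descendants_eq_labels:
  assumes "distinct (labels T)" "c \<in> subtrees T"
  shows "{w. (label c, w) \<in> (edges T)\<^sup>*} = set (labels c)"
proof (intro equalityI subsetI)
  fix w assume "w \<in> {w. (label c, w) \<in> (edges T)\<^sup>*}"
  then have "(label c, w) \<in> (edges T)\<^sup>*" by simp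
  then show "w \<in> set (labels c)"
    by (induction rule: rtrancl_induct) (auto simp: label_in_labels intro: edge_stays_below[OF assms])
qed (auto intro: descendants_subset[OF assms(2)])

lemma walk_exists:
  assumes "x \<in> set (labels T)" "y \<in> set (labels T)"
  shows "\<exists>k. (x, y) \<in> adjacent T ^^ k"
proof -
  have "(label T, z) \<in> (adjacent T)\<^sup>*" if "z \<in> set (labels T)" for z
    using descendants_subset[OF subtree_refl that] rtrancl_mono[of "edges T" "adjacent T"] by auto
  then obtain i j where "(label T, x) \<in> adjacent T ^^ i" "(label T, y) \<in> adjacent T ^^ j"
    using assms by (meson rtrancl_imp_relpow)
  then have "(x, y) \<in> adjacent T ^^ (i + j)" using walk_reverse by (metis relpow_add relcompI)
  then show ?thesis by blast
qed

lemma tree_dist_walk: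
  "x \<in> set (labels T) \<Longrightarrow> y \<in> set (labels T) \<Longrightarrow> (x, y) \<in> adjacent T ^^ tree_dist T x y"
  unfolding tree_dist_def by (rule LeastI_ex) (rule walk_exists)

lemma tree_dist_le: "(x, y) \<in> adjacent T ^^ k \<Longrightarrow> tree_dist T x y \<le> k"
  unfolding tree_dist_def by (rule Least_le)

locale edge_of_tree =
  fixes T p c :: ptree
  assumes distinct: "distinct (labels T)" and parent: "p \<in> subtrees T" and child: "c \<in> set (children p)"
begin

lemma child_subtree: "c \<in> subtrees T"
  using subtree_trans[OF parent] subtree_child[OF child] by auto

lemma parent_outside: "label p \<notin> set (labels c)"
  using distinct_subtree[OF parent distinct] child by (cases p) auto

lemma label_parent: "label p \<in> set (labels T)" and label_child: "label c \<in> set (labels T)"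
  using parent child_subtree by (auto simp: set_labels)

lemma adjacent: "(label p, label c) \<in> adjacent T" "(label c, label p) \<in> adjacent T"
  using parent child by (auto simp: edges_iff)

lemma tree_dist_below:
  assumes "u \<in> set (labels c)"
  shows "tree_dist T (label p) u = Suc (tree_dist T (label c) u)"
proof (rule antisym)
  have u: "u \<in> set (labels T)" using assms labels_subtree[OF child_subtree] by auto
  show "tree_dist T (label p) u \<le> Suc (tree_dist T (label c) u)"
    by (intro tree_dist_le relpow_Suc_I2[OF adjacent(1)] tree_dist_walk label_child u)
  show "Suc (tree_dist T (label c) u) \<le> tree_dist T (label p) u"
    using walk_into_subtree[OF distinct parent child tree_dist_walk[OF label_parent u] parent_outside assms]
      tree_dist_le[of "label c" u _ T] by fastforce
qed

lemma tree_dist_outside: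
  assumes "u \<in> set (labels T)" "u \<notin> set (labels c)"
  shows "tree_dist T (label c) u = Suc (tree_dist T (label p) u)"
proof (rule antisym)
  show "tree_dist T (label c) u \<le> Suc (tree_dist T (label p) u)"
    by (intro tree_dist_le relpow_Suc_I2[OF adjacent(2)] tree_dist_walk label_parent assms)
  have "(u, label c) \<in> adjacent T ^^ tree_dist T (label c) u"
    by (rule walk_reverse) (intro tree_dist_walk label_child assms)
  from walk_into_subtree[OF distinct parent child this assms(2) label_in_labels]
  show "Suc (tree_dist T (label p) u) \<le> tree_dist T (label c) u"
    using tree_dist_le[OF walk_reverse, of u "label p" _ T] by fastforce
qed

text \<open>Moving from the parent to the child brings the nodes below the child one step closer and takes all others one step
away.\<close>

lemma dist_sum_edge:
  "(\<Sum>u\<in>set (labels T). tree_dist T (label p) u) + tree_size T =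
   (\<Sum>u\<in>set (labels T). tree_dist T (label c) u) + 2 * tree_size c"
proof -
  let ?C = "set (labels c)" and ?O = "set (labels T) - set (labels c)"
  have un: "set (labels T) = ?C \<union> ?O" using labels_subtree[OF child_subtree] by auto
  have split: "(\<Sum>u\<in>set (labels T). f u) = sum f ?C + sum f ?O" for f :: "nat \<Rightarrow> nat"
    by (subst un, rule sum.union_disjoint) auto
  have "card ?C = tree_size c"
    using distinct_card[OF distinct_subtree[OF child_subtree distinct]] by (simp add: length_labels)
  moreover have "card ?C + card ?O = tree_size T"
    using distinct_card[OF distinct] split[of "\<lambda>_. 1"] by (simp add: length_labels)
  moreover have "(\<Sum>u\<in>?C. tree_dist T (label p) u) = (\<Sum>u\<in>?C. tree_dist T (label c) u) + card ?C"
    using tree_dist_below by (simp add: sum_Suc)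
  moreover have "(\<Sum>u\<in>?O. tree_dist T (label c) u) = (\<Sum>u\<in>?O. tree_dist T (label p) u) + card ?O"
    using tree_dist_outside by (simp add: sum_Suc)
  ultimately show ?thesis unfolding split by linarith
qed

end

definition dist_sum :: "ptree \<Rightarrow> ptree \<Rightarrow> nat" where
  "dist_sum T s = (\<Sum>u\<in>set (labels T). tree_dist T (label s) u)"

lemma dist_sum_child:
  assumes "distinct (labels T)" "p \<in> subtrees T" "c \<in> set (children p)"
  shows "dist_sum T p + tree_size T = dist_sum T c + 2 * tree_size c"
  using edge_of_tree.dist_sum_edge[of T p c] assms by (simp add: edge_of_tree_def dist_sum_def)

text \<open>Descending into a subtree with at most half of the nodes never decreases the sum of distances, and all subtrees met on
the way down are small as well.\<close>

lemma dist_sum_light: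
  assumes "distinct (labels T)"
  shows "t \<in> subtrees T \<Longrightarrow> 2 * tree_size t \<le> tree_size T \<Longrightarrow> s \<in> subtrees t \<Longrightarrow>
    dist_sum T t \<le> dist_sum T s"
proof (induction t)
  case (Node l ts)
  from Node.prems(3) show ?case
  proof (cases rule: subtree_cases)
    case (2 t)
    have t: "t \<in> subtrees T" using subtree_trans[OF Node.prems(1)] subtree_child[OF 2(1)] by auto
    have "2 * tree_size t \<le> tree_size T" using size_child[OF 2(1)] Node.prems(2) by linarith
    moreover from this have "dist_sum T t \<le> dist_sum T s" using Node.IH[of t] 2 t by auto
    ultimately show ?thesis using dist_sum_child[OF assms Node.prems(1) 2(1)] by linarith
  qed simp
qed

text \<open>With \<open>K = n div 2\<close>, the root of \<open>c\<close> is the last node on the path of nodes with more than half of the nodes below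
them.\<close>

definition heavy_end :: "nat \<Rightarrow> ptree \<Rightarrow> bool" where
  "heavy_end K c \<longleftrightarrow> tree_size c > K \<and> (\<forall>t\<in>set (children c). tree_size t \<le> K)"

lemma heavy_end_exists:
  assumes "tree_size T > K"
  obtains c where "c \<in> subtrees T" "heavy_end K c"
proof -
  obtain c where c: "c \<in> subtrees T \<and> tree_size c > K"
      "\<And>s. s \<in> subtrees T \<and> tree_size s > K \<Longrightarrow> tree_size c \<le> tree_size s"
    using ex_has_least_nat[of "\<lambda>s. s \<in> subtrees T \<and> tree_size s > K" T tree_size] assms subtree_refl
    by blast
  have "tree_size t \<le> K" if t: "t \<in> set (children c)" for t
  proof (rule ccontr)
    assume "\<not> ?thesis"
    then have "tree_size c \<le> tree_size t"
      using subtree_trans[of c T] subtree_child[OF t] c by force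
    then show False using size_child[OF t] by simp
  qed
  then show ?thesis using that c by (auto simp: heavy_end_def)
qed

text \<open>Along the path of heavy subtrees down to \<open>c\<close> the sum of distances decreases strictly, and it does not decrease on any
other way down. The induction covers all subtrees \<open>q\<close> on this path; a sibling of the next one on the path is light
because both together would have more than \<open>n\<close> nodes.\<close>

lemma dist_sum_heavy_end:
  assumes "distinct (labels T)" "heavy_end (tree_size T div 2) c"
  shows "q \<in> subtrees T \<Longrightarrow> c \<in> subtrees q \<Longrightarrow> s \<in> subtrees q \<Longrightarrow>
    dist_sum T c \<le> dist_sum T s \<and> (dist_sum T s = dist_sum T c \<longrightarrow> s \<in> subtrees c)"
proof (induction q arbitrary: s)
  case (Node l ts)
  let ?q = "Node l ts"
  note step = dist_sum_child[OF assms(1) Node.prems(1)]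
  have sub: "t \<in> subtrees T" if "t \<in> set ts" for t
    using subtree_trans[OF Node.prems(1)] subtree_child[of t ?q] that by auto
  have light: "dist_sum T ?q \<le> dist_sum T s'"
    if "t \<in> set ts" "2 * tree_size t \<le> tree_size T" "s' \<in> subtrees t" for t s'
    using dist_sum_light[OF assms(1) sub[OF that(1)] that(2,3)] step[of t] that by simp
  show ?case
  proof (cases "c = ?q")
    case True
    from Node.prems(3) show ?thesis
    proof (cases rule: subtree_cases)
      case 1
      then show ?thesis using True subtree_refl by auto
    next
      case (2 t)
      then have "2 * tree_size t \<le> tree_size T" using assms(2) True by (force simp: heavy_end_def)
      then show ?thesis using light[of t s] 2 True Node.prems(3) by auto
    qed
  next
    case False
    then obtain t where t: "t \<in> set ts" "c \<in> subtrees t" using Node.prems(2) by auto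
    have heavy: "2 * tree_size t > tree_size T"
      using size_subtree[OF t(2)] assms(2) by (auto simp: heavy_end_def)
    have less: "dist_sum T c < dist_sum T ?q"
      using Node.IH[OF t(1) sub[OF t(1)] t(2) subtree_refl] step[of t] t(1) heavy by auto
    from Node.prems(3) show ?thesis
    proof (cases rule: subtree_cases)
      case 1
      then show ?thesis using less by auto
    next
      case (2 t')
      show ?thesis
      proof (cases "t' = t")
        case True
        then show ?thesis using Node.IH[OF t(1) sub[OF t(1)] t(2)] 2 by auto
      next
        case False
        have "tree_size t + tree_size t' < tree_size T"
          using size_siblings[of t ts t'] t 2 False size_subtree[OF Node.prems(1)] by auto
        then have "dist_sum T ?q \<le> dist_sum T s" using light[of t' s] 2 heavy by auto
        then show ?thesis using less by auto
      qed
    qed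
  qed
qed

text \<open>Another minimiser can only be a descendant of the root of \<open>c\<close>. Walks to it from the root of \<open>T\<close> pass the root of \<open>c\<close>,
so it is farther away.\<close>

lemma centroid_heavy_end:
  assumes "distinct (labels T)" "c \<in> subtrees T" "heavy_end (tree_size T div 2) c"
  shows "centroid T = label c"
proof -
  note opt = dist_sum_heavy_end[OF assms(1,3) subtree_refl assms(2)]
  have c: "label c \<in> set (labels T)" using assms(2) by (auto simp: set_labels)
  have cent: "label c \<in> centroids T"
    using opt c by (auto simp: centroids_def dist_sum_def set_labels)
  have below: "x \<in> set (labels c)" if x: "x \<in> centroids T" for x
  proof -
    obtain s where s: "s \<in> subtrees T" "x = label s" using x by (auto simp: centroids_def set_labels)
    have "dist_sum T s \<le> dist_sum T c" using x s c by (auto simp: centroids_def dist_sum_def)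
    then have "s \<in> subtrees c" using opt[OF s(1)] by auto
    then show ?thesis using s by (auto simp: set_labels)
  qed
  have "finite (centroids T)" by (auto simp: centroids_def)
  then have min: "centroid T \<in> centroids T"
      "\<not> tree_dist T (label T) (label c) < tree_dist T (label T) (centroid T)"
    using arg_min_if_finite[of "centroids T" "tree_dist T (label T)"] cent
    unfolding centroid_def by blast+
  show ?thesis
  proof (rule ccontr)
    assume ne: "centroid T \<noteq> label c"
    let ?d = "tree_dist T (label T) (centroid T)"
    have x: "centroid T \<in> set (labels T)" using min(1) by (auto simp: centroids_def)
    note w = tree_dist_walk[OF label_in_labels x]
    have "tree_dist T (label T) (label c) < ?d"
    proof (cases "c = T")
      case True
      have "?d \<noteq> 0"
      proof
        assume "?d = 0"
        then show False using w ne True by simp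
      qed
      moreover have "tree_dist T (label T) (label c) \<le> 0" using True by (intro tree_dist_le) simp
      ultimately show ?thesis by linarith
    next
      case False
      then obtain p where p: "p \<in> subtrees T" "c \<in> set (children p)" using subtree_parent assms(2) by blast
      have "label T \<notin> set (labels c)"
      proof
        assume "label T \<in> set (labels c)"
        then obtain s where s: "s \<in> subtrees c" "label s = label T" by (auto simp: set_labels)
        then have "s = T" using subtree_unique[OF assms(1)] subtree_trans[OF assms(2)] subtree_refl by blast
        then show False using size_subtree[OF s(1)] size_proper_subtree[OF assms(2) False] by simp
      qed
      from walk_into_subtree[OF assms(1) p w this below[OF min(1)]]
      obtain i j where ij: "?d = Suc (i + j)" "(label T, label p) \<in> adjacent T ^^ i"
        "(label c, centroid T) \<in> adjacent T ^^ j" by auto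
      have "(label p, label c) \<in> adjacent T" using p by (auto simp: edges_iff)
      then have "tree_dist T (label T) (label c) \<le> Suc i" using ij(2) by (intro tree_dist_le relpow_Suc_I)
      moreover have "j \<noteq> 0"
      proof
        assume "j = 0"
        then show False using ij(3) ne by simp
      qed
      ultimately show ?thesis using ij(1) by linarith
    qed
    then show False using min(2) by simp
  qed
qed

lemma centroid_subtree_size_heavy_end:
  assumes "distinct (labels T)" "c \<in> subtrees T" "heavy_end (tree_size T div 2) c"
  shows "centroid_subtree_size T = tree_size c"
  unfolding centroid_subtree_size_def centroid_heavy_end[OF assms] descendants_eq_labels[OF assms(1,2)]
  using distinct_card[OF distinct_subtree[OF assms(2,1)]] by (simp add: length_labels)

section \<open>The heavy path crosses a given size at most once\<close>

definition crossing :: "nat \<Rightarrow> nat \<Rightarrow> nat \<Rightarrow> nat \<Rightarrow> real" where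
  "crossing K M a b = (if M < a \<and> K < b \<and> b \<le> M then 1 else 0)"

lemma child_stat_crossing_small:
  assumes "tree_size T \<le> M"
  shows "child_stat \<alpha> (crossing K M) T = 0"
proof -
  have "child_stat \<alpha> (crossing K M) T = child_stat \<alpha> (\<lambda>_ _. 0) T"
    using assms by (intro child_stat_cong) (auto simp: crossing_def)
  then show ?thesis by (simp add: child_stat_zero)
qed

text \<open>A tree with at most \<open>2 K + 1\<close> nodes has at most one child subtree of more than \<open>K\<close> nodes. Following these subtrees
down to \<open>c\<close>, a counted pair occurs exactly where the size falls to \<open>M\<close> or below.\<close>

lemma child_stat_crossing:
  assumes "K \<le> M" "heavy_end K c"
  shows "c \<in> subtrees q \<Longrightarrow> tree_size q \<le> 2 * K + 1 \<Longrightarrow> M < tree_size q \<Longrightarrow>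
    child_stat \<alpha> (crossing K M) q = (if tree_size c \<le> M then 1 else 0)"
proof (induction q)
  case (Node l ts)
  let ?S = "tree_size (Node l ts)"
  have light: "crossing K M ?S (tree_size t) = 0" "child_stat \<alpha> (crossing K M) t = 0"
    if "tree_size t \<le> K" for t
    using that assms(1) by (auto simp: crossing_def intro: child_stat_crossing_small)
  have lights: "(\<Sum>t\<leftarrow>us. crossing K M ?S (tree_size t)) = 0" "(\<Sum>t\<leftarrow>us. child_stat \<alpha> (crossing K M) t) = 0"
    if "\<And>t. t \<in> set us \<Longrightarrow> tree_size t \<le> K" for us
    using light that by (induction us) (auto simp del: tree_size.simps)
  \<comment> \<open>Virtual children have size \<open>0 \<le> K\<close> and are not counted.\<close>
  have slot: "crossing K M ?S 0 = 0" by (simp add: crossing_def)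
  show ?case
  proof (cases "c = Node l ts")
    case True
    then have "tree_size t \<le> K" if "t \<in> set ts" for t
      using assms(2) that by (auto simp: heavy_end_def)
    then show ?thesis using lights[of ts] slot Node.prems(3) True
      by (simp del: tree_size.simps)
  next
    case False
    then obtain t where t: "t \<in> set ts" "c \<in> subtrees t" using Node.prems(1) by auto
    obtain us vs where ts: "ts = us @ t # vs" using split_list[OF t(1)] by auto
    have K: "K < tree_size t" using size_subtree[OF t(2)] assms(2) by (auto simp: heavy_end_def)
    have s: "sum_list (map tree_size us) + sum_list (map tree_size vs) \<le> K"
      using Node.prems(2) K ts by simp
    have us: "tree_size u \<le> K" if "u \<in> set us" for u
      using member_le_sum_list[of "tree_size u" "map tree_size us"] that s by force
    have vs: "tree_size u \<le> K" if "u \<in> set vs" for u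
      using member_le_sum_list[of "tree_size u" "map tree_size vs"] that s by force
    have "child_stat \<alpha> (crossing K M) (Node l ts) =
        crossing K M ?S (tree_size t) + child_stat \<alpha> (crossing K M) t"
      unfolding child_stat.simps slot using lights[OF us] lights[OF vs]
      by (simp add: ts del: tree_size.simps)
    also have "\<dots> = (if tree_size c \<le> M then 1 else 0)"
    proof (cases "tree_size t \<le> M")
      case True
      then show ?thesis
        using K Node.prems(3) child_stat_crossing_small[OF True] size_subtree[OF t(2)]
        by (simp add: crossing_def del: tree_size.simps)
    next
      case False
      have "tree_size t \<le> 2 * K + 1" using size_child[of t "Node l ts"] t(1) Node.prems(2) by simp
      moreover have "crossing K M ?S (tree_size t) = 0" using False by (simp add: crossing_def)
      ultimately show ?thesis using Node.IH[OF t(1,2)] False by simp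
    qed
    finally show ?thesis .
  qed
qed

lemma child_stat_crossing_centroid:
  assumes "T \<in> increasing_trees n" "n div 2 \<le> M" "M < n"
  shows "child_stat \<alpha> (crossing (n div 2) M) T = (if centroid_subtree_size T \<le> M then 1 else 0)"
proof -
  have T: "distinct (labels T)" "tree_size T = n"
    using assms(1) tree_size_increasing_trees by (auto simp: increasing_trees_def)
  obtain c where c: "c \<in> subtrees T" "heavy_end (n div 2) c"
    using heavy_end_exists[of "n div 2" T] T assms by auto
  show ?thesis
    using child_stat_crossing[OF assms(2) c(2,1), of \<alpha>] centroid_subtree_size_heavy_end[OF T(1) c(1)] c T assms
    by simp
qed

lemma centroid_subtree_size_bounds:
  assumes "T \<in> increasing_trees n" "n \<ge> 1"
  shows "n div 2 < centroid_subtree_size T" "centroid_subtree_size T \<le> n"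
proof -
  have T: "distinct (labels T)" "tree_size T = n"
    using assms(1) tree_size_increasing_trees by (auto simp: increasing_trees_def)
  obtain c where c: "c \<in> subtrees T" "heavy_end (n div 2) c"
    using heavy_end_exists[of "n div 2" T] T assms by auto
  then have "centroid_subtree_size T = tree_size c"
    using centroid_subtree_size_heavy_end[OF T(1) c(1)] T by simp
  then show "n div 2 < centroid_subtree_size T" "centroid_subtree_size T \<le> n"
    using c size_subtree[OF c(1)] T by (auto simp: heavy_end_def)
qed

section \<open>The limit law\<close>

text \<open>The limiting distribution function on \<open>[1/2, 1)\<close>.\<close>

definition limit_cdf :: "real \<Rightarrow> real \<Rightarrow> real" where
  "limit_cdf \<alpha> x = (if \<alpha> = 1 then ln (2 * x) / x
     else 2 * (\<alpha> / (\<alpha> - 1)) * ((2 * x) powr (-1) - (2 * x) powr (- \<alpha>)))"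

text \<open>Both inequalities follow from \<open>2 powr s \<le> 1 + s\<close> on \<open>[0, 1]\<close>, the convexity of the exponential; for negative \<open>t\<close>
multiply by \<open>1 + t\<close> and use \<open>(1 + t) (1 - t) \<le> 1\<close>.\<close>

lemma powr_Bernoulli:
  assumes "1 \<le> y" "y \<le> 2" "-1 < t" "t \<le> (1::real)"
  shows "0 \<le> t \<Longrightarrow> y powr t \<le> 1 + t" and "t \<le> 0 \<Longrightarrow> 1 + t \<le> y powr t"
proof -
  have B: "2 powr s \<le> 1 + s" if "0 \<le> s" "s \<le> 1" for s :: real
    using Youngs_inequality_0[of s "1 - s" 2 1] that by simp
  {
    assume t: "0 \<le> t"
    have "y powr t \<le> 2 powr t" using assms t by (intro powr_mono2) auto
    then show "y powr t \<le> 1 + t" using B[of t] t assms by simp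
  next
    assume t: "t \<le> 0"
    have "y powr (- t) \<le> 2 powr (- t)" using assms t by (intro powr_mono2) auto
    then have le: "y powr (- t) \<le> 1 - t" using B[of "- t"] t assms by simp
    have "(1 + t) * y powr (- t) \<le> (1 + t) * (1 - t)" using le assms by (intro mult_left_mono) auto
    also have "\<dots> \<le> 1" by (simp add: algebra_simps)
    finally show "1 + t \<le> y powr t" using assms by (simp add: powr_minus field_simps)
  }
qed

lemma limit_density_eq:
  "\<alpha> \<noteq> 1 \<Longrightarrow> limit_density \<alpha> \<theta> =
    4 * (\<alpha> / (\<alpha> - 1)) * (\<alpha> * (2 * \<theta>) powr (- (\<alpha> + 1)) - (2 * \<theta>) powr (-2))"
  by (simp add: limit_density_def)

lemma has_derivative_limit_cdf:
  assumes "x > 0"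
  shows "(limit_cdf \<alpha> has_real_derivative limit_density \<alpha> x) (at x)"
proof (cases "\<alpha> = 1")
  case True
  have "((\<lambda>x. ln (2 * x) / x) has_real_derivative (1 - ln (2 * x)) / x\<^sup>2) (at x)"
    using assms by (auto intro!: derivative_eq_intros simp: power2_eq_square)
  then show ?thesis using True assms by (simp add: limit_cdf_def[abs_def] limit_density_1)
next
  case False
  have e: "- \<alpha> - 1 = - (\<alpha> + 1)" "-1 - 1 = (-2 :: real)" by simp_all
  have d: "((\<lambda>x. (2 * x) powr r) has_real_derivative r * (2 * x) powr (r - 1) * 2) (at x)" for r
    using DERIV_fun_powr[of "\<lambda>x. 2 * x" 2 x r] assms by (auto intro!: derivative_eq_intros)
  have "((\<lambda>x. 2 * (\<alpha> / (\<alpha> - 1)) * ((2 * x) powr (-1) - (2 * x) powr (- \<alpha>))) has_real_derivative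
      2 * (\<alpha> / (\<alpha> - 1)) * ((-1) * (2 * x) powr (-1 - 1) * 2 - (- \<alpha>) * (2 * x) powr (- \<alpha> - 1) * 2)) (at x)"
    by (intro DERIV_cmult DERIV_diff d)
  also have "2 * (\<alpha> / (\<alpha> - 1)) * ((-1) * (2 * x) powr (-1 - 1) * 2 - (- \<alpha>) * (2 * x) powr (- \<alpha> - 1) * 2)
      = limit_density \<alpha> x"
    unfolding limit_density_eq[OF False] e by (simp add: algebra_simps)
  finally show ?thesis using False by (simp add: limit_cdf_def[abs_def])
qed

text \<open>For \<open>\<alpha> \<noteq> 1\<close> the density is, up to positive factors, \<open>(\<alpha> - y powr (\<alpha> - 1)) / (\<alpha> - 1)\<close> with \<open>y = 2 x \<in> [1, 2]\<close>; here the
restriction \<open>\<alpha> \<le> 2\<close> enters.\<close>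

lemma limit_density_nonneg:
  assumes "0 < \<alpha>" "\<alpha> \<le> 2" "1/2 \<le> x" "x \<le> 1"
  shows "limit_density \<alpha> x \<ge> 0"
proof (cases "\<alpha> = 1")
  case True
  have "ln (2 * x) \<le> ln 2" using assms by simp
  also have "\<dots> < 1" using ln_2_less_1 by simp
  finally show ?thesis using True assms by (simp add: limit_density_1)
next
  case False
  have e: "\<alpha> * (2 * x) powr (- (\<alpha> + 1)) - (2 * x) powr (-2) =
      (2 * x) powr (- (\<alpha> + 1)) * (\<alpha> - (2 * x) powr (\<alpha> - 1))"
    by (simp add: right_diff_distrib powr_add[symmetric])
  have "(\<alpha> - (2 * x) powr (\<alpha> - 1)) / (\<alpha> - 1) \<ge> 0"
    using powr_Bernoulli[of "2 * x" "\<alpha> - 1"] assms False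
    by (cases "\<alpha> > 1") (auto intro: divide_nonneg_nonneg divide_nonpos_nonpos)
  then have "4 * \<alpha> * (2 * x) powr (- (\<alpha> + 1)) * ((\<alpha> - (2 * x) powr (\<alpha> - 1)) / (\<alpha> - 1)) \<ge> 0"
    using assms by (intro mult_nonneg_nonneg) auto
  then show ?thesis unfolding limit_density_eq[OF False] e by (simp add: field_simps)
qed

lemma limit_atom_eq: "\<alpha> \<noteq> 0 \<Longrightarrow> limit_atom \<alpha> = 1 - limit_cdf \<alpha> 1"
proof (cases "\<alpha> = 1")
  case True
  then show ?thesis by (simp add: limit_atom_1 limit_cdf_def)
qed (simp add: limit_cdf_def limit_atom_def powr_minus powr_diff field_simps)

lemma limit_atom_nonneg:
  assumes "0 < \<alpha>" "\<alpha> \<le> 2"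
  shows "limit_atom \<alpha> \<ge> 0"
proof (cases "\<alpha> = 1")
  case True
  then show ?thesis using ln_2_less_1 by (simp add: limit_atom_1)
next
  case False
  have "(\<alpha> - 2 powr (\<alpha> - 1)) / (\<alpha> - 1) \<ge> 0"
    using powr_Bernoulli[of 2 "\<alpha> - 1"] assms False
    by (cases "\<alpha> > 1") (auto intro: divide_nonneg_nonneg divide_nonpos_nonpos)
  then have "2 powr (- (\<alpha> - 1)) * ((\<alpha> - 2 powr (\<alpha> - 1)) / (\<alpha> - 1)) \<ge> 0"
    by (rule mult_nonneg_nonneg[OF powr_ge_zero])
  also have "2 powr (- (\<alpha> - 1)) * ((\<alpha> - 2 powr (\<alpha> - 1)) / (\<alpha> - 1)) = limit_atom \<alpha>"
  proof -
    have "2 powr (- (\<alpha> - 1)) * (\<alpha> - 2 powr (\<alpha> - 1)) = \<alpha> * 2 powr (- (\<alpha> - 1)) - 1"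
      by (simp add: right_diff_distrib powr_add[symmetric])
    then show ?thesis using False by (simp add: limit_atom_def field_simps)
  qed
  finally show ?thesis .
qed

lemma limit_cdf_half: "limit_cdf \<alpha> (1/2) = 0"
  by (simp add: limit_cdf_def)

lemma nn_integral_limit_density:
  assumes "0 < \<alpha>" "\<alpha> \<le> 2" "1/2 \<le> x" "x \<le> 1"
  shows "(\<integral>\<^sup>+\<theta>\<in>{1/2..x}. ennreal (limit_density \<alpha> \<theta>) \<partial>lborel) = ennreal (limit_cdf \<alpha> x)"
proof -
  \<comment> \<open>Outside the interval the limit defining \<open>limit_density 1\<close> need not exist, so measurability is shown for a truncation.\<close>
  define f where "f \<theta> = indicator {1/2..x} \<theta> * (if \<alpha> = 1 then (1 - ln (2 * \<theta>)) / \<theta>\<^sup>2 else limit_density \<alpha> \<theta>)" for \<theta>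
  have f: "f \<theta> = limit_density \<alpha> \<theta>" if "\<theta> \<in> {1/2..x}" for \<theta>
    using that by (auto simp: f_def limit_density_1)
  have "(\<integral>\<^sup>+\<theta>\<in>{1/2..x}. ennreal (limit_density \<alpha> \<theta>) \<partial>lborel) =
      (\<integral>\<^sup>+\<theta>. ennreal (f \<theta>) * indicator {1/2..x} \<theta> \<partial>lborel)"
    by (intro nn_integral_cong) (auto simp: f split: split_indicator)
  also have "\<dots> = ennreal (limit_cdf \<alpha> x - limit_cdf \<alpha> (1/2))"
  proof (rule nn_integral_FTC_Icc)
    show "f \<in> borel_measurable borel"
      unfolding f_def[abs_def] by (cases "\<alpha> = 1") (simp_all add: limit_density_eq)
    show "DERIV (limit_cdf \<alpha>) \<theta> :> f \<theta>" if "\<theta> \<in> {1/2..x}" for \<theta>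
      using that has_derivative_limit_cdf[of \<theta> \<alpha>] f[of \<theta>] by simp
    show "0 \<le> f \<theta>" if "\<theta> \<in> {1/2..x}" for \<theta>
      using that assms limit_density_nonneg[of \<alpha> \<theta>] f[of \<theta>] by simp
  qed (use assms in auto)
  finally show ?thesis unfolding limit_cdf_half by simp
qed

lemma limit_cdf_nonneg:
  assumes "0 < \<alpha>" "\<alpha> \<le> 2" "1/2 \<le> x" "x \<le> 1"
  shows "limit_cdf \<alpha> x \<ge> 0"
proof -
  have "limit_cdf \<alpha> (1/2) \<le> limit_cdf \<alpha> x"
  proof (rule DERIV_nonneg_imp_nondecreasing[OF assms(3)])
    fix y assume y: "1/2 \<le> y" "y \<le> x"
    have "(limit_cdf \<alpha> has_real_derivative limit_density \<alpha> y) (at y)" "limit_density \<alpha> y \<ge> 0"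
      using y assms by (auto intro: has_derivative_limit_cdf limit_density_nonneg)
    then show "\<exists>z. DERIV (limit_cdf \<alpha>) y :> z \<and> z \<ge> 0" by blast
  qed
  then show ?thesis by (simp add: limit_cdf_half)
qed

lemma nn_integral_limit_density_right_open:
  assumes "0 < \<alpha>" "\<alpha> \<le> 2"
  shows "(\<integral>\<^sup>+\<theta>\<in>{1/2..<1}. ennreal (limit_density \<alpha> \<theta>) \<partial>lborel) = ennreal (limit_cdf \<alpha> 1)"
proof -
  have "(\<integral>\<^sup>+\<theta>\<in>{1/2..<1}. ennreal (limit_density \<alpha> \<theta>) \<partial>lborel) =
      (\<integral>\<^sup>+\<theta>\<in>{1/2..1}. ennreal (limit_density \<alpha> \<theta>) \<partial>lborel)"
    by (intro nn_integral_cong_AE eventually_mono[OF AE_lborel_singleton[of 1]]) (auto split: split_indicator)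
  also have "\<dots> = ennreal (limit_cdf \<alpha> 1)"
    using nn_integral_limit_density[of \<alpha> 1] assms by simp
  finally show ?thesis .
qed

lemma emeasure_limit_law_ge_1:
  assumes "0 < \<alpha>" "\<alpha> \<le> 2" "A \<in> sets borel" "{1/2..1} \<subseteq> A"
  shows "emeasure (limit_law \<alpha>) A = 1"
proof -
  have "A \<inter> {1/2..<1} = {1/2..<1}" "1 \<in> A" using assms(4) by (auto simp: subset_iff)
  then have "emeasure (limit_law \<alpha>) A = ennreal (limit_cdf \<alpha> 1) + ennreal (limit_atom \<alpha>)"
    unfolding emeasure_limit_law[OF assms(3)]
    using nn_integral_limit_density_right_open[OF assms(1,2)] by simp
  also have "\<dots> = ennreal (limit_cdf \<alpha> 1 + limit_atom \<alpha>)"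
    using assms limit_cdf_nonneg[of \<alpha> 1] limit_atom_nonneg by (intro ennreal_plus[symmetric]) auto
  finally show ?thesis using assms limit_atom_eq[of \<alpha>] by simp
qed

lemma space_limit_law: "space (limit_law \<alpha>) = UNIV"
  by (simp add: limit_law_def space_measure_of_conv)

lemma sets_limit_law: "sets (limit_law \<alpha>) = sets borel"
  unfolding limit_law_def
  by (metis (no_types, lifting) sets.sigma_sets_eq sets_measure_of space_borel subset_UNIV Pow_UNIV)

lemma real_distribution_limit_law:
  assumes "0 < \<alpha>" "\<alpha> \<le> 2"
  shows "real_distribution (limit_law \<alpha>)"
proof -
  have "prob_space (limit_law \<alpha>)"
    by (rule prob_spaceI) (simp add: space_limit_law emeasure_limit_law_ge_1 assms)
  then show ?thesis
    by (simp add: real_distribution_def real_distribution_axioms_def sets_limit_law space_limit_law)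
qed

lemma cdf_limit_law:
  assumes "0 < \<alpha>" "\<alpha> \<le> 2"
  shows "cdf (limit_law \<alpha>) x = (if x \<le> 1/2 then 0 else if x < 1 then limit_cdf \<alpha> x else 1)"
proof -
  consider "x < 1/2" | "1/2 \<le> x" "x < 1" | "1 \<le> x" by linarith
  then show ?thesis
  proof cases
    case 1
    then have "{..x} \<inter> {1/2..<1} = {}" by auto
    then have "emeasure (limit_law \<alpha>) {..x} = 0" using 1 by (simp add: emeasure_limit_law)
    then show ?thesis using 1 by (simp add: cdf_def measure_def)
  next
    case 2
    then have "{..x} \<inter> {1/2..<1} = {1/2..x}" by auto
    then have "emeasure (limit_law \<alpha>) {..x} = ennreal (limit_cdf \<alpha> x)"
      using 2 assms nn_integral_limit_density[of \<alpha> x] by (simp add: emeasure_limit_law)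
    then have "cdf (limit_law \<alpha>) x = limit_cdf \<alpha> x"
      using 2 assms limit_cdf_nonneg[of \<alpha> x] by (simp add: cdf_def measure_def)
    moreover have "limit_cdf \<alpha> x = 0" if "x = 1/2" unfolding that by (rule limit_cdf_half)
    moreover have "x \<le> 1/2 \<Longrightarrow> x = 1/2" using 2 by simp
    ultimately show ?thesis using 2 by auto
  next
    case 3
    then have "emeasure (limit_law \<alpha>) {..x} = 1" using assms by (intro emeasure_limit_law_ge_1) auto
    then show ?thesis using 3 by (simp add: cdf_def measure_def)
  qed
qed

section \<open>Asymptotics of the growth ratio\<close>

text \<open>Euler's product for the Gamma function.\<close>

lemma growth_ratio_asymp:
  assumes "\<alpha> > 0"
  shows "(\<lambda>m. growth_ratio \<alpha> (Suc m) / real m powr (\<alpha> - 1)) \<longlonglongrightarrow> 1 / Gamma \<alpha>"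
proof (rule Lim_transform_eventually)
  show "(\<lambda>m. 1 / Gamma_series' \<alpha> m) \<longlonglongrightarrow> 1 / Gamma \<alpha>"
    using Gamma_real_pos[OF assms] by (intro tendsto_intros Gamma_series'_LIMSEQ) auto
  show "eventually (\<lambda>m. 1 / Gamma_series' \<alpha> m = growth_ratio \<alpha> (Suc m) / real m powr (\<alpha> - 1)) sequentially"
    using eventually_gt_at_top[of 0]
  proof eventually_elim
    case (elim m)
    have "fact m = real m * fact (m - 1)" using elim by (simp add: fact_reduce)
    then show ?case using elim
      by (simp add: Gamma_series'_def growth_ratio_def powr_def left_diff_distrib exp_diff)
  qed
qed

lemma growth_ratio_quotient_limit:
  assumes "\<alpha> > 0" "a > 0" "b > 0"
    and K: "(\<lambda>n. real (K n) / real n) \<longlonglongrightarrow> a" "filterlim K at_top sequentially"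
    and M: "(\<lambda>n. real (M n) / real n) \<longlonglongrightarrow> b" "filterlim M at_top sequentially"
  shows "(\<lambda>n. growth_ratio \<alpha> (Suc (K n)) / growth_ratio \<alpha> (Suc (M n))) \<longlonglongrightarrow> (a / b) powr (\<alpha> - 1)"
proof -
  let ?r = "\<lambda>m. growth_ratio \<alpha> (Suc m) / real m powr (\<alpha> - 1)"
  have G: "Gamma \<alpha> \<noteq> 0" using Gamma_real_pos[OF assms(1)] by (metis less_irrefl)
  have KM: "(\<lambda>n. (real (K n) / real n) / (real (M n) / real n)) \<longlonglongrightarrow> a / b"
    using K M assms by (intro tendsto_intros) auto
  have "(\<lambda>n. ?r (K n) / ?r (M n) * ((real (K n) / real n) / (real (M n) / real n)) powr (\<alpha> - 1))
      \<longlonglongrightarrow> (1 / Gamma \<alpha>) / (1 / Gamma \<alpha>) * (a / b) powr (\<alpha> - 1)"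
  proof (rule tendsto_mult[OF tendsto_divide tendsto_powr[OF KM tendsto_const]])
    show "(\<lambda>n. ?r (K n)) \<longlonglongrightarrow> 1 / Gamma \<alpha>" "(\<lambda>n. ?r (M n)) \<longlonglongrightarrow> 1 / Gamma \<alpha>"
      using filterlim_compose[OF growth_ratio_asymp[OF assms(1)]] K(2) M(2) by blast+
  qed (use assms G in auto)
  also have "(1 / Gamma \<alpha>) / (1 / Gamma \<alpha>) * (a / b) powr (\<alpha> - 1) = (a / b) powr (\<alpha> - 1)"
    using G by simp
  finally show ?thesis
  proof (rule Lim_transform_eventually)
    have "eventually (\<lambda>n. K n > 0) sequentially" "eventually (\<lambda>n. M n > 0) sequentially"
      using K(2) M(2) by (auto intro: eventually_compose_filterlim[OF eventually_gt_at_top])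
    then show "eventually (\<lambda>n. ?r (K n) / ?r (M n) * ((real (K n) / real n) / (real (M n) / real n)) powr (\<alpha> - 1)
        = growth_ratio \<alpha> (Suc (K n)) / growth_ratio \<alpha> (Suc (M n))) sequentially"
      using eventually_gt_at_top[of 0]
    proof eventually_elim
      case (elim n)
      have "((real (K n) / real n) / (real (M n) / real n)) = real (K n) / real (M n)" using elim by simp
      then show ?case using elim by (simp add: powr_divide)
    qed
  qed
qed

text \<open>The case \<open>\<alpha> = 1\<close>, in which \<open>growth_ratio\<close> is constant and the sum over child sizes is a piece of the harmonic
series.\<close>

lemma harmonic_window_limit:
  assumes "a > 0" "b > 0" "\<And>n. K n \<le> M n"
    and K: "(\<lambda>n. real (K n) / real n) \<longlonglongrightarrow> a" "filterlim K at_top sequentially"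
    and M: "(\<lambda>n. real (M n) / real n) \<longlonglongrightarrow> b" "filterlim M at_top sequentially"
  shows "(\<lambda>n. \<Sum>j\<in>{K n<..M n}. 1 / real j) \<longlonglongrightarrow> ln (b / a)"
proof -
  let ?e = "\<lambda>m. harm m - ln (real m) :: real"
  have MK: "(\<lambda>n. (real (M n) / real n) / (real (K n) / real n)) \<longlonglongrightarrow> b / a"
    using K M assms by (intro tendsto_intros) auto
  have "(\<lambda>n. ?e (M n) - ?e (K n) + ln ((real (M n) / real n) / (real (K n) / real n)))
      \<longlonglongrightarrow> euler_mascheroni - euler_mascheroni + ln (b / a)"
    using assms filterlim_compose[OF euler_mascheroni_LIMSEQ K(2)]
      filterlim_compose[OF euler_mascheroni_LIMSEQ M(2)]
    by (intro tendsto_intros MK) auto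
  then have "(\<lambda>n. ?e (M n) - ?e (K n) + ln ((real (M n) / real n) / (real (K n) / real n)))
      \<longlonglongrightarrow> ln (b / a)" by simp
  then show ?thesis
  proof (rule Lim_transform_eventually)
    have "eventually (\<lambda>n. K n > 0) sequentially" "eventually (\<lambda>n. M n > 0) sequentially"
      using K(2) M(2) by (auto intro: eventually_compose_filterlim[OF eventually_gt_at_top])
    then show "eventually (\<lambda>n. ?e (M n) - ?e (K n) + ln ((real (M n) / real n) / (real (K n) / real n))
        = (\<Sum>j\<in>{K n<..M n}. 1 / real j)) sequentially"
      using eventually_gt_at_top[of 0]
    proof eventually_elim
      case (elim n)
      have l: "ln ((real (M n) / real n) / (real (K n) / real n)) = ln (real (M n)) - ln (real (K n))"
        using elim by (simp add: ln_div)
      have "{1..M n} = {1..K n} \<union> {K n<..M n}" using assms(3)[of n] by auto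
      then have "harm (M n) = harm (K n) + (\<Sum>j\<in>{K n<..M n}. 1 / real j)"
        unfolding harm_def inverse_eq_divide by (simp only:) (subst sum.union_disjoint, auto)
      then show ?case unfolding l by simp
    qed
  qed
qed

section \<open>The distribution of the centroid subtree size\<close>

context very_simple_trees
begin

text \<open>The sum telescopes: the right-hand side at \<open>M\<close> exceeds that at \<open>M + 1\<close> by the summand for \<open>m = M + 1\<close>. The summand
\<open>m = n\<close>, where \<open>subtree_mean\<close> is exceptional, is the right-hand side at \<open>n - 1\<close>.\<close>

lemma sum_subtree_mean_tail:
  assumes "M < n"
  shows "(\<Sum>m=Suc M..n. subtree_mean n m / growth_ratio \<alpha> m) =
    (real n + \<alpha> - 1) / ((real M + \<alpha>) * growth_ratio \<alpha> (Suc M))"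
proof -
  have "M \<le> n - 1" using assms by simp
  then show ?thesis
  proof (induction M rule: inc_induct)
    case base
    obtain k where n: "n = Suc k" using assms by (cases n) auto
    have "real k + \<alpha> \<noteq> 0" using alpha_pos by linarith
    then show ?case by (simp add: n subtree_mean_def)
  next
    case (step M)
    let ?g = "growth_ratio \<alpha> (Suc M)"
    have M: "Suc M < n" using step by simp
    have pos: "?g > 0" "real M + \<alpha> > 0" "real M + \<alpha> + 1 > 0" "real n + \<alpha> - 1 > 0"
      using growth_ratio_pos alpha_pos M by auto
    have g: "growth_ratio \<alpha> (Suc (Suc M)) = (real M + \<alpha>) * ?g / real (Suc M)"
      using growth_ratio_Suc[of "Suc M"] by (simp add: field_simps)
    have merge: "\<alpha> * N / (P * Q) / g + N / (Q * (P * g / S)) = N * (\<alpha> + S) / (P * Q * g)" for N P Q S g :: real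
      by (simp add: add_divide_distrib distrib_left mult_ac)
    have "(\<Sum>m=Suc M..n. subtree_mean n m / growth_ratio \<alpha> m) =
        subtree_mean n (Suc M) / ?g + (\<Sum>m=Suc (Suc M)..n. subtree_mean n m / growth_ratio \<alpha> m)"
      using M by (intro sum.atLeast_Suc_atMost) simp
    also have "\<dots> = \<alpha> * (real n + \<alpha> - 1) / ((real M + \<alpha>) * (real M + \<alpha> + 1)) / ?g +
        (real n + \<alpha> - 1) / ((real M + \<alpha> + 1) * ((real M + \<alpha>) * ?g / real (Suc M)))"
      unfolding step.IH g using M by (simp add: subtree_mean_def add_ac)
    also have "\<dots> = (real n + \<alpha> - 1) * (\<alpha> + real (Suc M)) / ((real M + \<alpha>) * (real M + \<alpha> + 1) * ?g)"
      by (rule merge)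
    also have "\<alpha> + real (Suc M) = real M + \<alpha> + 1" by simp
    finally show ?case using pos by simp
  qed
qed

lemma child_total_crossing:
  assumes "n \<ge> 1" "K \<le> M" "M < n"
  shows "child_total n (crossing K M) = total_weight n *
    (\<alpha> * (real n + \<alpha> - 1) / ((real M + \<alpha>) * growth_ratio \<alpha> (Suc M)) *
      (\<Sum>j\<in>{K<..M}. growth_ratio \<alpha> j / real j))"
proof -
  have "crossing K M a b = (\<Sum>m=Suc M..n. \<Sum>j\<in>{K<..M}. at_pair m j a b)" if "a \<le> n" for a b
  proof -
    have "(\<Sum>m=Suc M..n. \<Sum>j\<in>{K<..M}. at_pair m j a b) =
        (\<Sum>m=Suc M..n. if m = a then \<Sum>j\<in>{K<..M}. if j = b then 1 else 0 else 0)"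
      by (intro sum.cong) (auto simp: at_pair_def intro!: sum.neutral sum.cong)
    then show ?thesis using that by (simp add: crossing_def)
  qed
  then have "child_stat \<alpha> (crossing K M) T =
      child_stat \<alpha> (\<lambda>a b. \<Sum>m=Suc M..n. \<Sum>j\<in>{K<..M}. at_pair m j a b) T" if "T \<in> increasing_trees n" for T
    using tree_size_increasing_trees[OF that] by (intro child_stat_cong) auto
  then have "child_total n (crossing K M) =
      child_total n (\<lambda>a b. \<Sum>m=Suc M..n. \<Sum>j\<in>{K<..M}. at_pair m j a b)"
    by (simp add: child_total_def)
  also have "\<dots> = (\<Sum>m=Suc M..n. \<Sum>j\<in>{K<..M}. total_weight n * edge_mean n m j)"
    by (simp add: child_total_sum child_total_at_pair[OF assms(1)])
  also have "\<dots> = (\<Sum>m=Suc M..n. \<Sum>j\<in>{K<..M}.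
      total_weight n * \<alpha> * (subtree_mean n m / growth_ratio \<alpha> m) * (growth_ratio \<alpha> j / real j))"
    by (intro sum.cong refl) (auto simp: edge_mean_def child_mean_def mult_ac)
  also have "\<dots> = total_weight n * \<alpha> * (\<Sum>m=Suc M..n. subtree_mean n m / growth_ratio \<alpha> m) *
      (\<Sum>j\<in>{K<..M}. growth_ratio \<alpha> j / real j)"
    unfolding sum_distrib_left sum_distrib_right by (rule sum.swap)
  finally show ?thesis unfolding sum_subtree_mean_tail[OF assms(3)] by simp
qed

lemma prob_random_tree:
  assumes "n \<ge> 1"
  shows "measure_pmf.prob (random_tree c1 c2 n) {T. P T} =
    (\<Sum>T\<in>increasing_trees n. weight c1 c2 T * (if P T then 1 else 0)) / total_weight n"
proof -
  have "set_pmf (random_tree c1 c2 n) \<subseteq> increasing_trees n"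
    by (auto simp: set_pmf_iff pmf_random_tree[OF admissible assms] split: if_splits)
  then have "measure_pmf.prob (random_tree c1 c2 n) {T. P T} =
      measure_pmf.prob (random_tree c1 c2 n) {T \<in> increasing_trees n. P T}"
    by (intro measure_pmf.finite_measure_eq_AE) (auto simp: AE_measure_pmf_iff)
  also have "\<dots> = (\<Sum>T\<in>{T \<in> increasing_trees n. P T}. pmf (random_tree c1 c2 n) T)"
    by (intro measure_measure_pmf_finite) (simp add: finite_increasing_trees)
  also have "\<dots> = (\<Sum>T\<in>increasing_trees n. weight c1 c2 T * (if P T then 1 else 0) / total_weight n)"
    by (simp add: pmf_random_tree[OF admissible assms] finite_increasing_trees sum.inter_filter total_weight_def
        cong: if_cong) (intro sum.cong; simp)
  finally show ?thesis by (simp add: sum_divide_distrib)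
qed

text \<open>The exact distribution of the centroid subtree size: the indicator of the event is the number of pairs in which the
heavy path crosses the size \<open>M\<close>, and the expected number of pairs of each size is known.\<close>

lemma prob_centroid_subtree_size_le:
  assumes "n \<ge> 1" "n div 2 \<le> M" "M < n"
  shows "measure_pmf.prob (random_tree c1 c2 n) {T. centroid_subtree_size T \<le> M} =
    \<alpha> * (real n + \<alpha> - 1) / ((real M + \<alpha>) * growth_ratio \<alpha> (Suc M)) *
      (\<Sum>j\<in>{n div 2<..M}. growth_ratio \<alpha> j / real j)"
proof -
  have "(\<Sum>T\<in>increasing_trees n. weight c1 c2 T * (if centroid_subtree_size T \<le> M then 1 else 0)) =
      child_total n (crossing (n div 2) M)"
    unfolding child_total_def using child_stat_crossing_centroid[OF _ assms(2,3)] by simp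
  then show ?thesis
    unfolding prob_random_tree[OF assms(1)] child_total_crossing[OF assms]
    using total_weight_pos[OF assms(1)] by simp
qed

text \<open>For \<open>\<alpha> \<noteq> 1\<close> the increments of \<open>growth_ratio\<close> at \<open>j\<close> are \<open>(\<alpha> - 1) * growth_ratio \<alpha> j / j\<close>.\<close>

lemma sum_growth_ratio:
  assumes "\<alpha> \<noteq> 1" "K \<le> M"
  shows "(\<Sum>j\<in>{K<..M}. growth_ratio \<alpha> j / real j) =
    (growth_ratio \<alpha> (Suc M) - growth_ratio \<alpha> (Suc K)) / (\<alpha> - 1)"
  using assms(2)
proof (induction M rule: dec_induct)
  case (step M)
  have "growth_ratio \<alpha> (Suc (Suc M)) - growth_ratio \<alpha> (Suc M) =
      (\<alpha> - 1) * (growth_ratio \<alpha> (Suc M) / real (Suc M))"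
    using growth_ratio_Suc[of "Suc M"] by (simp add: field_simps)
  then have "growth_ratio \<alpha> (Suc M) / real (Suc M) =
      (growth_ratio \<alpha> (Suc (Suc M)) - growth_ratio \<alpha> (Suc M)) / (\<alpha> - 1)"
    using assms(1) by (simp del: of_nat_Suc)
  moreover have "{K<..Suc M} = insert (Suc M) {K<..M}" using step by auto
  ultimately show ?case using step.IH by (simp add: diff_divide_distrib)
qed simp

lemma growth_ratio_one: "growth_ratio 1 m = 1"
  by (simp add: growth_ratio_def pochhammer_fact[symmetric])

section \<open>Convergence in distribution\<close>

text \<open>In the exact formula the first factor tends to \<open>\<alpha> / x\<close>. The sum over child sizes between \<open>n div 2\<close> and
\<open>x n\<close>, divided by \<open>growth_ratio \<alpha> (M + 1)\<close>, has a limit depending on \<open>1/2\<close> and \<open>x\<close> only through their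
quotient \<open>1 / (2 x)\<close>.\<close>

lemma centroid_limit_middle:
  assumes x: "1/2 \<le> x" "x < 1"
  shows "(\<lambda>n. measure_pmf.prob (random_tree c1 c2 n) {T. centroid_subtree_size T \<le> nat \<lfloor>x * real n\<rfloor>})
    \<longlonglongrightarrow> limit_cdf \<alpha> x"
proof -
  define K M :: "nat \<Rightarrow> nat" where "K n = n div 2" and "M n = nat \<lfloor>x * real n\<rfloor>" for n
  have K_real: "real (K n) = of_int \<lfloor>real n / 2\<rfloor>" for n
    by (simp add: K_def floor_divide_of_nat_eq[of n 2, simplified])
  have M_real: "real (M n) = of_int \<lfloor>x * real n\<rfloor>" for n using x by (simp add: M_def)
  have K_lim: "(\<lambda>n. real (K n) / real n) \<longlonglongrightarrow> 1/2" unfolding K_real by real_asymp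
  have M_lim: "(\<lambda>n. real (M n) / real n) \<longlonglongrightarrow> x" unfolding M_real using x by real_asymp
  have K_top: "filterlim K at_top sequentially"
    unfolding K_def[abs_def] by (rule filterlim_at_top_div_const_nat) simp
  have KM: "K n \<le> M n" for n
  proof -
    have "real n / 2 \<le> x * real n" using mult_right_mono[OF x(1), of "real n"] by simp
    moreover have "real (n div 2) \<le> real n / 2" by linarith
    ultimately show ?thesis unfolding K_def M_def by (intro le_nat_floor) linarith
  qed
  have M_top: "filterlim M at_top sequentially"
    by (rule filterlim_at_top_mono[OF K_top]) (simp add: KM)
  let ?S = "\<lambda>n. (\<Sum>j\<in>{K n<..M n}. growth_ratio \<alpha> j / real j) / growth_ratio \<alpha> (Suc (M n))"
  let ?L = "if \<alpha> = 1 then ln (2 * x) else (1 - (1 / (2 * x)) powr (\<alpha> - 1)) / (\<alpha> - 1)"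
  have S: "?S \<longlonglongrightarrow> ?L"
  proof (cases "\<alpha> = 1")
    case True
    then show ?thesis
      using harmonic_window_limit[OF _ _ KM K_lim K_top M_lim M_top] x
      by (simp add: growth_ratio_one True mult.commute)
  next
    case False
    have "?S = (\<lambda>n. (1 - growth_ratio \<alpha> (Suc (K n)) / growth_ratio \<alpha> (Suc (M n))) / (\<alpha> - 1))"
      using growth_ratio_pos by (auto simp: fun_eq_iff sum_growth_ratio[OF False KM] field_simps less_imp_neq[symmetric])
    moreover have "(\<lambda>n. growth_ratio \<alpha> (Suc (K n)) / growth_ratio \<alpha> (Suc (M n)))
        \<longlonglongrightarrow> (1 / (2 * x)) powr (\<alpha> - 1)"
      using growth_ratio_quotient_limit[OF alpha_pos _ _ K_lim K_top M_lim M_top] x by simp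
    ultimately show ?thesis using False by (auto intro!: tendsto_intros)
  qed
  have r: "(\<lambda>n. (real n + \<alpha> - 1) / (real (M n) + \<alpha>)) \<longlonglongrightarrow> 1 / x"
  proof (rule Lim_transform_eventually)
    show "(\<lambda>n. (1 + (\<alpha> - 1) / real n) / (real (M n) / real n + \<alpha> / real n)) \<longlonglongrightarrow> 1 / x"
    proof -
      have "(\<lambda>n. (1 + (\<alpha> - 1) / real n) / (real (M n) / real n + \<alpha> / real n)) \<longlonglongrightarrow> (1 + 0) / (x + 0)"
        using x by (intro tendsto_divide tendsto_add M_lim tendsto_const lim_const_over_n) auto
      then show ?thesis by simp
    qed
    show "eventually (\<lambda>n. (1 + (\<alpha> - 1) / real n) / (real (M n) / real n + \<alpha> / real n) =
        (real n + \<alpha> - 1) / (real (M n) + \<alpha>)) sequentially"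
      using eventually_gt_at_top[of 0]
    proof eventually_elim
      case (elim n)
      have "1 + (\<alpha> - 1) / real n = (real n + \<alpha> - 1) / real n"
        "real (M n) / real n + \<alpha> / real n = (real (M n) + \<alpha>) / real n"
        using elim by (simp_all add: field_simps)
      then show ?case using elim by simp
    qed
  qed
  have "(\<lambda>n. \<alpha> * ((real n + \<alpha> - 1) / (real (M n) + \<alpha>)) * ?S n) \<longlonglongrightarrow> \<alpha> * (1 / x) * ?L"
    by (intro tendsto_mult tendsto_const r S)
  also have "\<alpha> * (1 / x) * ?L = limit_cdf \<alpha> x"
  proof (cases "\<alpha> = 1")
    case True
    then show ?thesis by (simp add: limit_cdf_def)
  next
    case False
    have "(2 * x) powr (- \<alpha>) = (2 * x) powr (-1) * (2 * x) powr (- (\<alpha> - 1))"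
      unfolding powr_add[symmetric] by simp
    then have "(2 * x) powr (-1) - (2 * x) powr (- \<alpha>) = (2 * x) powr (-1) * (1 - (2 * x) powr (- (\<alpha> - 1)))"
      by (simp only: right_diff_distrib mult_1_right)
    also have "(2 * x) powr (- (\<alpha> - 1)) = (1 / (2 * x)) powr (\<alpha> - 1)"
      using x by (simp only: powr_minus_divide) (simp add: powr_divide)
    also have "(2 * x) powr (-1) = 1 / (2 * x)" using x by (simp add: powr_minus_divide)
    finally show ?thesis using False x by (simp add: limit_cdf_def)
  qed
  finally show ?thesis
  proof (rule Lim_transform_eventually)
    show "eventually (\<lambda>n. \<alpha> * ((real n + \<alpha> - 1) / (real (M n) + \<alpha>)) * ?S n =
        measure_pmf.prob (random_tree c1 c2 n) {T. centroid_subtree_size T \<le> nat \<lfloor>x * real n\<rfloor>}) sequentially"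
      using eventually_ge_at_top[of 1]
    proof eventually_elim
      case (elim n)
      have "x * real n < real n" using elim x by simp
      then have "M n < n" unfolding M_def using x by (simp add: nat_less_iff floor_less_iff)
      then have "measure_pmf.prob (random_tree c1 c2 n) {T. centroid_subtree_size T \<le> M n} =
          \<alpha> * (real n + \<alpha> - 1) / ((real (M n) + \<alpha>) * growth_ratio \<alpha> (Suc (M n))) *
          (\<Sum>j\<in>{K n<..M n}. growth_ratio \<alpha> j / real j)"
        using prob_centroid_subtree_size_le[of n "M n"] KM[of n] elim by (simp add: K_def)
      then show ?case by (simp add: M_def)
    qed
  qed
qed

lemma cdf_centroid_proportion:
  assumes "n \<ge> 1" "x \<ge> 0"
  shows "cdf (distr (measure_pmf (random_tree c1 c2 n)) borel (\<lambda>T. real (centroid_subtree_size T) / real n)) x =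
    measure_pmf.prob (random_tree c1 c2 n) {T. centroid_subtree_size T \<le> nat \<lfloor>x * real n\<rfloor>}"
proof -
  have "real s / real n \<le> x \<longleftrightarrow> s \<le> nat \<lfloor>x * real n\<rfloor>" for s
    using assms by (simp add: divide_le_eq le_nat_iff le_floor_iff)
  then show ?thesis by (simp add: cdf_def measure_distr vimage_def)
qed

lemma prob_centroid_small:
  assumes "n \<ge> 1" "M \<le> n div 2"
  shows "measure_pmf.prob (random_tree c1 c2 n) {T. centroid_subtree_size T \<le> M} = 0"
  using centroid_subtree_size_bounds(1)[OF _ assms(1)] assms(2)
  unfolding prob_random_tree[OF assms(1)] by (force intro!: sum.neutral)

lemma prob_centroid_full:
  assumes "n \<ge> 1" "n \<le> M"
  shows "measure_pmf.prob (random_tree c1 c2 n) {T. centroid_subtree_size T \<le> M} = 1"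
proof -
  have "(\<Sum>T\<in>increasing_trees n. weight c1 c2 T * (if centroid_subtree_size T \<le> M then 1 else 0)) = total_weight n"
    unfolding total_weight_def using centroid_subtree_size_bounds(2)[OF _ assms(1)] assms(2)
    by (intro sum.cong) (auto intro: order_trans)
  then show ?thesis unfolding prob_random_tree[OF assms(1)] using total_weight_pos[OF assms(1)] by simp
qed

end

theorem theorem20:
  fixes c1 c2 \<alpha> :: real
  assumes "admissible c1 c2" and "\<alpha> = 1 + c2 / c1"
  shows "real_distribution (limit_law \<alpha>) \<and>
    weak_conv_m
      (\<lambda>n. distr (measure_pmf (random_tree c1 c2 n)) borel
             (\<lambda>T. real (centroid_subtree_size T) / real n))
      (limit_law \<alpha>)"
proof -
  interpret very_simple_trees c1 c2 \<alpha> using assms by unfold_locales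
  let ?F = "\<lambda>n. cdf (distr (measure_pmf (random_tree c1 c2 n)) borel
    (\<lambda>T. real (centroid_subtree_size T) / real n))"
  let ?P = "\<lambda>n m. measure_pmf.prob (random_tree c1 c2 n) {T. centroid_subtree_size T \<le> m}"
  have nonneg: "(\<lambda>n. ?F n x) \<longlonglongrightarrow> l" if "x \<ge> 0" "(\<lambda>n. ?P n (nat \<lfloor>x * real n\<rfloor>)) \<longlonglongrightarrow> l" for x l
    by (rule Lim_transform_eventually[OF that(2)])
      (use eventually_ge_at_top[of 1] in eventually_elim, simp add: cdf_centroid_proportion that)
  have "(\<lambda>n. ?F n x) \<longlonglongrightarrow> cdf (limit_law \<alpha>) x" for x
  proof -
    consider "x < 0" | "0 \<le> x" "x < 1/2" | "1/2 \<le> x" "x < 1" | "1 \<le> x" by linarith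
    then show ?thesis
    proof cases
      case 1
      then have "?F n x = 0" for n
      proof -
        have "\<not> real s / real n \<le> x" for s
          using 1 divide_nonneg_nonneg[of "real s" "real n"] by linarith
        then show ?thesis by (simp add: cdf_def measure_distr vimage_def)
      qed
      then show ?thesis using 1 by (simp add: cdf_limit_law[OF alpha_pos alpha_le_2])
    next
      case 2
      have "(\<lambda>n. ?F n x) \<longlonglongrightarrow> 0"
      proof (rule nonneg[OF 2(1)], rule Lim_transform_eventually[OF tendsto_const])
        show "eventually (\<lambda>n. 0 = ?P n (nat \<lfloor>x * real n\<rfloor>)) sequentially"
          using eventually_ge_at_top[of 1]
        proof eventually_elim
          case (elim n)
          have "x * real n < real n / 2" using 2 elim by simp
          then have "nat \<lfloor>x * real n\<rfloor> \<le> n div 2" by linarith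
          then show ?case using prob_centroid_small[OF elim] by simp
        qed
      qed
      then show ?thesis using 2 by (simp add: cdf_limit_law[OF alpha_pos alpha_le_2])
    next
      case 3
      have "(\<lambda>n. ?F n x) \<longlonglongrightarrow> limit_cdf \<alpha> x"
        using 3 by (intro nonneg centroid_limit_middle) auto
      moreover have "limit_cdf \<alpha> x = 0" if "x = 1/2" unfolding that by (rule limit_cdf_half)
      moreover have "x \<le> 1/2 \<Longrightarrow> x = 1/2" using 3 by simp
      ultimately show ?thesis using 3 unfolding cdf_limit_law[OF alpha_pos alpha_le_2] by auto
    next
      case 4
      have "(\<lambda>n. ?F n x) \<longlonglongrightarrow> 1"
      proof (rule nonneg, use 4 in simp, rule Lim_transform_eventually[OF tendsto_const])
        show "eventually (\<lambda>n. 1 = ?P n (nat \<lfloor>x * real n\<rfloor>)) sequentially"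
          using eventually_ge_at_top[of 1]
        proof eventually_elim
          case (elim n)
          have "real n \<le> x * real n" using 4 elim by simp
          then have "n \<le> nat \<lfloor>x * real n\<rfloor>" by (rule le_nat_floor)
          then show ?case using prob_centroid_full[OF elim] by simp
        qed
      qed
      then show ?thesis using 4 by (simp add: cdf_limit_law[OF alpha_pos alpha_le_2])
    qed
  qed
  then show ?thesis
    using real_distribution_limit_law[OF alpha_pos alpha_le_2]
    by (simp add: weak_conv_m_def weak_conv_def)
qed

end
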